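(* Let $\otimes$ be either multiplication on $[0,1]$ or the Łukasiewicz tensor $u\otimes v=\max(0,u+v-1)$ on $[0,1]$. Then the functor $$C:\mathsf{PosComp}\longrightarrow\mathsf{Mon}([0,1]\text{-}\mathsf{FinSup})^{\mathrm{op}},$$ sending a partially ordered compact space $X$ to $CX=\mathsf{PosComp}(X,[0,1]^{\mathrm{op}})$ with pointwise structure and $f:X\to Y$ to $CY\to CX$, $\psi\mapsto\psi\cdot f$, is fully faithful.
   Context: **Enriched categories.** Let $\otimes$ be the given tensor on $[0,1]$, and let $\hom(u,-)$ be the right adjoint of $u\otimes-$, i.e. $u\otimes v\le w\iff v\le\hom(u,w)$. A $[0,1]$-category is a set $X$ with a map $a:X\times X\to[0,1]$ with $a(x,x)=1$ and $a(x,y)\otimes a(y,z)\le a(x,z)$. A $[0,1]$-functor $f:(X,a)\to(Y,b)$ is a map with $a(x,y)\le b(f(x),f(y))$. The natural order is $x\le y\iff a(x,y)=1$; $(X,a)$ is separated if this order is anti-symmetric. A $u$-copower of $x$ is an element $x\otimes u$ with $a(x\otimes u,y)=\hom(u,a(x,y))$ for all $y$. $(X,a)$ is finitely cocomplete if it has all colimits of weighted diagrams with finite underlying set; equivalently, it has all copowers ($u\in[0,1]$), a bottom element, and all binary suprema in the natural order, with $a(x\vee y,z)=a(x,z)\wedge a(y,z)$ for all $z$. A map between finitely cocomplete $[0,1]$-categories is a finitely cocontinuous $[0,1]$-functor iff it is monotone and preserves copowers and binary suprema. $[0,1]\text{-}\mathsf{FinSup}$ is the category of separated finitely cocomplete $[0,1]$-categories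 and finitely cocontinuous $[0,1]$-functors. **Monoids.** Objects of $\mathsf{Mon}([0,1]\text{-}\mathsf{FinSup})$ are objects $X$ of $[0,1]\text{-}\mathsf{FinSup}$ with an associative commutative operation $\otimes:X\times X\to X$ whose unit is the top element $1$ of $X$, such that each $x\otimes-:X\to X$ is a finitely cocontinuous $[0,1]$-functor. Morphisms are finitely cocontinuous $[0,1]$-functors preserving the unit and the multiplication. **Spaces.** A partially ordered compact space is a compact space $X$ with a partial order $\le$ that is closed in $X\times X$ (so $X$ is Hausdorff). $\mathsf{PosComp}$ is the category of these spaces and monotone continuous maps. $[0,1]^{\mathrm{op}}$ is $[0,1]$ with the Euclidean topology and the dual of the usual order. Thus $CX$ is the set of continuous order-reversing maps $X\to[0,1]$ (with $[0,1]$ usually ordered), with all operations ($\vee$, $-\otimes u$, $\otimes$, $0$, $1$) pointwise and $[0,1]$-category structure $d(\psi_1,\psi_2)=\inf_x\hom(\psi_1(x),\psi_2(x))$. *)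

theory Defs
  imports "HOL-Analysis.Analysis" "HOL-Algebra.Group"
begin

text \<open>A tensor is a function on all of \<^typ>\<open>real\<close>, but only its values on the unit
  interval are ever used.\<close>

definition lukasiewicz :: "real \<Rightarrow> real \<Rightarrow> real" where
  "lukasiewicz u v = max 0 (u + v - 1)"

definition ihom :: "(real \<Rightarrow> real \<Rightarrow> real) \<Rightarrow> real \<Rightarrow> real \<Rightarrow> real" where
  "ihom T u w = Sup {v \<in> {0..1}. T u v \<le> w}"

text \<open>Infimum computed in the unit interval: the empty infimum is 1, whereas
  \<^const>\<open>Inf\<close> on the reals leaves it unspecified.\<close>

definition uInf :: "real set \<Rightarrow> real" where
  "uInf S = Inf (insert 1 S)"

definition ucat :: "(real \<Rightarrow> real \<Rightarrow> real) \<Rightarrow> 'a set \<Rightarrow> ('a \<Rightarrow> 'a \<Rightarrow> real) \<Rightarrow> bool" where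
  "ucat T X a \<longleftrightarrow>
     (\<forall>x\<in>X. \<forall>y\<in>X. a x y \<in> {0..1}) \<and>
     (\<forall>x\<in>X. a x x = 1) \<and>
     (\<forall>x\<in>X. \<forall>y\<in>X. \<forall>z\<in>X. T (a x y) (a y z) \<le> a x z)"

definition ufunctor ::
  "'a set \<Rightarrow> ('a \<Rightarrow> 'a \<Rightarrow> real) \<Rightarrow> 'b set \<Rightarrow> ('b \<Rightarrow> 'b \<Rightarrow> real) \<Rightarrow> ('a \<Rightarrow> 'b) \<Rightarrow> bool" where
  "ufunctor X a Y b f \<longleftrightarrow> f \<in> X \<rightarrow> Y \<and> (\<forall>x\<in>X. \<forall>y\<in>X. a x y \<le> b (f x) (f y))"

definition useparated :: "'a set \<Rightarrow> ('a \<Rightarrow> 'a \<Rightarrow> real) \<Rightarrow> bool" where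
  "useparated X a \<longleftrightarrow> (\<forall>x\<in>X. \<forall>y\<in>X. a x y = 1 \<and> a y x = 1 \<longrightarrow> x = y)"

definition ubottom :: "'a set \<Rightarrow> ('a \<Rightarrow> 'a \<Rightarrow> real) \<Rightarrow> 'a \<Rightarrow> bool" where
  "ubottom X a z \<longleftrightarrow> z \<in> X \<and> (\<forall>x\<in>X. a z x = 1)"

definition utop :: "'a set \<Rightarrow> ('a \<Rightarrow> 'a \<Rightarrow> real) \<Rightarrow> 'a \<Rightarrow> bool" where
  "utop X a z \<longleftrightarrow> z \<in> X \<and> (\<forall>x\<in>X. a x z = 1)"

definition usup :: "'a set \<Rightarrow> ('a \<Rightarrow> 'a \<Rightarrow> real) \<Rightarrow> 'a \<Rightarrow> 'a \<Rightarrow> 'a \<Rightarrow> bool" where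
  "usup X a x y z \<longleftrightarrow>
     z \<in> X \<and> a x z = 1 \<and> a y z = 1 \<and> (\<forall>t\<in>X. a x t = 1 \<and> a y t = 1 \<longrightarrow> a z t = 1)"

definition ucopower ::
  "(real \<Rightarrow> real \<Rightarrow> real) \<Rightarrow> 'a set \<Rightarrow> ('a \<Rightarrow> 'a \<Rightarrow> real) \<Rightarrow> 'a \<Rightarrow> real \<Rightarrow> 'a \<Rightarrow> bool" where
  "ucopower T X a x u z \<longleftrightarrow> z \<in> X \<and> (\<forall>y\<in>X. a z y = ihom T u (a x y))"

text \<open>A weighted diagram in \<open>(X, a)\<close>: a functor \<open>h\<close> from an enriched category \<open>(I, d)\<close>
  together with a distributor \<open>w\<close> from \<open>(I, d)\<close> to the one-point category, that is, a
  contravariant presheaf on \<open>(I, d)\<close>.\<close>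

definition wdiagram ::
  "(real \<Rightarrow> real \<Rightarrow> real) \<Rightarrow> 'a set \<Rightarrow> ('a \<Rightarrow> 'a \<Rightarrow> real) \<Rightarrow>
   'i set \<Rightarrow> ('i \<Rightarrow> 'i \<Rightarrow> real) \<Rightarrow> ('i \<Rightarrow> 'a) \<Rightarrow> ('i \<Rightarrow> real) \<Rightarrow> bool" where
  "wdiagram T X a I d h w \<longleftrightarrow>
     ucat T I d \<and> ufunctor I d X a h \<and>
     (\<forall>i\<in>I. w i \<in> {0..1}) \<and> (\<forall>i\<in>I. \<forall>j\<in>I. T (d i j) (w j) \<le> w i)"

definition wcolimit ::
  "(real \<Rightarrow> real \<Rightarrow> real) \<Rightarrow> 'a set \<Rightarrow> ('a \<Rightarrow> 'a \<Rightarrow> real) \<Rightarrow>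
   'i set \<Rightarrow> ('i \<Rightarrow> 'a) \<Rightarrow> ('i \<Rightarrow> real) \<Rightarrow> 'a \<Rightarrow> bool" where
  "wcolimit T X a I h w z \<longleftrightarrow>
     z \<in> X \<and> (\<forall>y\<in>X. a z y = uInf ((\<lambda>i. ihom T (w i) (a (h i) y)) ` I))"

text \<open>Up to bijection every finite underlying set is a finite set of natural numbers, so
  index categories on \<^typ>\<open>nat\<close> suffice.\<close>

definition fin_cocomplete ::
  "(real \<Rightarrow> real \<Rightarrow> real) \<Rightarrow> 'a set \<Rightarrow> ('a \<Rightarrow> 'a \<Rightarrow> real) \<Rightarrow> bool" where
  "fin_cocomplete T X a \<longleftrightarrow>
     (\<forall>(I :: nat set) d h w. finite I \<and> wdiagram T X a I d h w \<longrightarrow>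
        (\<exists>z. wcolimit T X a I h w z))"

definition fin_cocontinuous ::
  "(real \<Rightarrow> real \<Rightarrow> real) \<Rightarrow> 'a set \<Rightarrow> ('a \<Rightarrow> 'a \<Rightarrow> real) \<Rightarrow>
   'b set \<Rightarrow> ('b \<Rightarrow> 'b \<Rightarrow> real) \<Rightarrow> ('a \<Rightarrow> 'b) \<Rightarrow> bool" where
  "fin_cocontinuous T X a Y b f \<longleftrightarrow>
     ufunctor X a Y b f \<and>
     (\<forall>(I :: nat set) d h w z. finite I \<and> wdiagram T X a I d h w \<and> wcolimit T X a I h w z \<longrightarrow>
        wcolimit T Y b I (f \<circ> h) w (f z))"

definition finsup ::
  "(real \<Rightarrow> real \<Rightarrow> real) \<Rightarrow> 'a set \<Rightarrow> ('a \<Rightarrow> 'a \<Rightarrow> real) \<Rightarrow> bool" where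
  "finsup T X a \<longleftrightarrow> ucat T X a \<and> useparated X a \<and> fin_cocomplete T X a"

record 'a umonoid = "'a monoid" +
  uhom :: "'a \<Rightarrow> 'a \<Rightarrow> real"

definition mon_finsup :: "(real \<Rightarrow> real \<Rightarrow> real) \<Rightarrow> 'a umonoid \<Rightarrow> bool" where
  "mon_finsup T M \<longleftrightarrow>
     finsup T (carrier M) (uhom M) \<and> comm_monoid M \<and>
     utop (carrier M) (uhom M) (one M) \<and>
     (\<forall>x\<in>carrier M. fin_cocontinuous T (carrier M) (uhom M) (carrier M) (uhom M) (mult M x))"

text \<open>Morphisms are extensional on the carrier, so that equality of HOL functions is
  equality of morphisms; composition is \<^const>\<open>compose\<close>. The same applies to morphisms
  of partially ordered spaces below.\<close>

definition mon_finsup_hom ::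
  "(real \<Rightarrow> real \<Rightarrow> real) \<Rightarrow> 'a umonoid \<Rightarrow> 'b umonoid \<Rightarrow> ('a \<Rightarrow> 'b) set" where
  "mon_finsup_hom T M N =
     {F \<in> extensional (carrier M) \<inter> hom M N.
        fin_cocontinuous T (carrier M) (uhom M) (carrier N) (uhom N) F \<and> F (one M) = one N}"

record 'a pospace =
  ptop :: "'a topology"
  pord :: "'a rel"

abbreviation points :: "'a pospace \<Rightarrow> 'a set" where
  "points X \<equiv> topspace (ptop X)"

definition poscomp :: "'a pospace \<Rightarrow> bool" where
  "poscomp X \<longleftrightarrow>
     compact_space (ptop X) \<and> partial_order_on (points X) (pord X) \<and>
     closedin (prod_topology (ptop X) (ptop X)) (pord X)"

definition poscomp_hom :: "'a pospace \<Rightarrow> 'b pospace \<Rightarrow> ('a \<Rightarrow> 'b) set" where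
  "poscomp_hom X Y =
     {f \<in> extensional (points X). continuous_map (ptop X) (ptop Y) f \<and>
        monotone_on (points X) (\<lambda>x y. (x, y) \<in> pord X) (\<lambda>x y. (x, y) \<in> pord Y) f}"

definition unit_op :: "real pospace" where
  "unit_op = \<lparr>ptop = top_of_set {0..1}, pord = {(u, v) \<in> {0..1} \<times> {0..1}. v \<le> u}\<rparr>"

definition C_obj :: "(real \<Rightarrow> real \<Rightarrow> real) \<Rightarrow> 'a pospace \<Rightarrow> ('a \<Rightarrow> real) umonoid" where
  "C_obj T X =
     \<lparr>carrier = poscomp_hom X unit_op,
      mult = (\<lambda>p q. \<lambda>x\<in>points X. T (p x) (q x)),
      one = (\<lambda>x\<in>points X. 1),
      uhom = (\<lambda>p q. uInf ((\<lambda>x. ihom T (p x) (q x)) ` points X))\<rparr>"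

definition C_map ::
  "'a pospace \<Rightarrow> 'b pospace \<Rightarrow> ('a \<Rightarrow> 'b) \<Rightarrow> ('b \<Rightarrow> real) \<Rightarrow> ('a \<Rightarrow> real)" where
  "C_map X Y f = (\<lambda>p\<in>poscomp_hom Y unit_op. compose (points X) p f)"

text \<open>Finite colimits in \<open>C_obj T X\<close> are determined by its enriched structure; this says
  that they are computed pointwise.\<close>

definition C_pointwise :: "(real \<Rightarrow> real \<Rightarrow> real) \<Rightarrow> 'a pospace \<Rightarrow> bool" where
  "C_pointwise T X \<longleftrightarrow>
     (let A = carrier (C_obj T X); d = uhom (C_obj T X) in
      ubottom A d (\<lambda>x\<in>points X. 0) \<and>
      (\<forall>p\<in>A. \<forall>q\<in>A. usup A d p q (\<lambda>x\<in>points X. max (p x) (q x))) \<and>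
      (\<forall>p\<in>A. \<forall>u\<in>{0..1}. ucopower T A d p u (\<lambda>x\<in>points X. T (p x) u)))"

end

(* For fullness, a morphism F from CY to CX composed with evaluation at a point x is a
   "character" of CY, and it suffices that every character phi is evaluation at a point of Y:
   these points form a map X -> Y, whose graph is closed, and monotonicity and uniqueness
   follow from an ordered Urysohn lemma (Nachbin) for Y.

   Given p with phi p > 0, a compactness argument yields a point y such that phi p <= T (phi q) u
   whenever p y < T (q y) u. Applied to a copower of p by some a < 1, and combined with powers
   of q, the Archimedean property of T gives phi q = 1 whenever q y = 1; passing to
   hom(q y, q), one gets q y <= phi q for all q, while phi p <= p y. Hence
   phi (hom (phi q, q)) = 1 for each q, and the same argument for a product of finitely many
   functions hom (phi q, q) produces a point at which phi agrees with evaluation on finitely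
   many q. Compactness then gives one point for all q. *)

theory Submission
  imports Defs
begin

section \<open>Compact ordered spaces: Hausdorffness, ordered normality and the ordered Urysohn
  lemma\<close>

lemma dyadic_between:
  fixes a b :: real
  assumes "0 \<le> a" "a < b" "b \<le> 1"
  obtains r where "r \<in> dyadics \<inter> {0..1}" "a < r" "r < b"
proof -
  obtain n q r where "of_nat q / 2^n \<le> a" "a < of_nat r / 2^n" "\<bar>q / 2^n - r / 2^n\<bar> < b - a"
    using padic_rational_approximation_straddle_pos_le[of "b - a" 2 a] assms
    by (smt (verit, del_insts))
  moreover from this have "of_nat r / 2^n \<in> dyadics" "of_nat r / 2^n < b"
    unfolding dyadics_def by (blast, argo)
  moreover from this assms have "real r / 2^n \<le> 1" by linarith
  ultimately show thesis
    using assms by (intro that[of "of_nat r / 2^n"]) auto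
qed

context
  fixes X :: "'a pospace"
  assumes X: "poscomp X"
begin

lemma poscomp_refl: "x \<in> points X \<Longrightarrow> (x, x) \<in> pord X"
  using X by (auto simp: poscomp_def partial_order_on_def preorder_on_def refl_on_def)

lemma poscomp_trans: "(x, y) \<in> pord X \<Longrightarrow> (y, z) \<in> pord X \<Longrightarrow> (x, z) \<in> pord X"
  using X by (auto simp: poscomp_def partial_order_on_def preorder_on_def trans_def)

lemma poscomp_antisym: "(x, y) \<in> pord X \<Longrightarrow> (y, x) \<in> pord X \<Longrightarrow> x = y"
  using X by (auto simp: poscomp_def partial_order_on_def antisym_def)

lemma poscomp_ordD: "(x, y) \<in> pord X \<Longrightarrow> x \<in> points X \<and> y \<in> points X"
  using X closedin_subset unfolding poscomp_def by fastforce

text \<open>The closure is the projection of a closed part of the order relation, and projecting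
  along a compact factor is a closed map.\<close>

lemma closedin_down_closure:
  assumes "closedin (ptop X) K"
  shows "closedin (ptop X) {x. \<exists>y\<in>K. (x, y) \<in> pord X}"
proof -
  have "closedin (prod_topology (ptop X) (ptop X)) (pord X \<inter> points X \<times> K)"
    using X assms by (intro closedin_Int) (auto simp: poscomp_def closedin_prod_Times_iff)
  moreover have "fst ` (pord X \<inter> points X \<times> K) = {x. \<exists>y\<in>K. (x, y) \<in> pord X}"
    by (force simp: image_iff dest: poscomp_ordD)
  ultimately show ?thesis
    using X closed_map_fst[of "ptop X" "ptop X"] unfolding closed_map_def poscomp_def by metis
qed

lemma closedin_up_closure:
  assumes "closedin (ptop X) K"
  shows "closedin (ptop X) {y. \<exists>x\<in>K. (x, y) \<in> pord X}"
proof -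
  have "closedin (prod_topology (ptop X) (ptop X)) (pord X \<inter> K \<times> points X)"
    using X assms by (intro closedin_Int) (auto simp: poscomp_def closedin_prod_Times_iff)
  moreover have "snd ` (pord X \<inter> K \<times> points X) = {y. \<exists>x\<in>K. (x, y) \<in> pord X}"
    by (force simp: image_iff dest: poscomp_ordD)
  ultimately show ?thesis
    using X closed_map_snd[of "ptop X" "ptop X"] unfolding closed_map_def poscomp_def by metis
qed

text \<open>By antisymmetry the diagonal is the order intersected with its converse, so it is
  closed.\<close>

lemma poscomp_Hausdorff_space: "Hausdorff_space (ptop X)"
proof -
  let ?P = "prod_topology (ptop X) (ptop X)"
  have R: "closedin ?P (pord X)" using X by (simp add: poscomp_def)
  have "continuous_map ?P ?P (\<lambda>p. (snd p, fst p))"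
    by (intro continuous_map_paired[THEN iffD2] conjI continuous_map_fst continuous_map_snd)
  from closedin_continuous_map_preimage[OF this R]
  have "closedin ?P {p \<in> topspace ?P. (snd p, fst p) \<in> pord X}" .
  with R have "closedin ?P (pord X \<inter> {p \<in> topspace ?P. (snd p, fst p) \<in> pord X})"
    by (rule closedin_Int)
  also have "pord X \<inter> {p \<in> topspace ?P. (snd p, fst p) \<in> pord X} = (\<lambda>x. (x, x)) ` points X"
    by (auto dest: poscomp_antisym intro: poscomp_refl)
  finally show ?thesis
    by (simp add: Hausdorff_space_closedin_diagonal)
qed

lemma poscomp_normal_space: "normal_space (ptop X)"
  using X poscomp_Hausdorff_space compact_Hausdorff_or_regular_imp_normal_space
  by (auto simp: poscomp_def)

definition down_closed :: "'a set \<Rightarrow> bool" where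
  "down_closed S \<longleftrightarrow> (\<forall>x y. (x, y) \<in> pord X \<and> y \<in> S \<longrightarrow> x \<in> S)"

text \<open>Nachbin's interpolation step, with every set kept down-closed. It plays the part that
  normality plays in the usual Urysohn construction.\<close>

lemma ordered_normality:
  assumes "closedin (ptop X) K" "openin (ptop X) V" "K \<subseteq> V" "down_closed K" "down_closed V"
  obtains U L where "openin (ptop X) U" "closedin (ptop X) L" "down_closed U" "down_closed L"
    "K \<subseteq> U" "U \<subseteq> L" "L \<subseteq> V"
proof -
  have "closedin (ptop X) (points X - V)" "disjnt K (points X - V)"
    using assms by (auto simp: disjnt_def)
  then obtain A B where AB: "openin (ptop X) A" "openin (ptop X) B" "K \<subseteq> A" "points X - V \<subseteq> B"
      "disjnt A B"
    using poscomp_normal_space assms(1) unfolding normal_space_def by metis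
  have KX: "K \<subseteq> points X" using assms(1) closedin_subset by blast
  \<comment> \<open>\<open>U\<close> is the largest down-closed subset of \<open>A\<close>, and
    \<open>L\<close> is the down-closure of the complement of \<open>B\<close>. Disjointness of
    \<open>A\<close> and \<open>B\<close> puts \<open>A\<close> inside that complement, whence
    \<open>U \<subseteq> L\<close>.\<close>
  define U where "U = points X - {y. \<exists>x\<in>points X - A. (x, y) \<in> pord X}"
  define L where "L = {x. \<exists>y\<in>points X - B. (x, y) \<in> pord X}"
  show thesis
  proof
    show "openin (ptop X) U"
      unfolding U_def using AB by (intro openin_diff closedin_up_closure) auto
    show "closedin (ptop X) L"
      unfolding L_def using AB by (intro closedin_down_closure) auto
    show "down_closed U" "down_closed L"
      unfolding U_def L_def down_closed_def by (auto dest: poscomp_trans poscomp_ordD)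
    show "K \<subseteq> U"
      unfolding U_def using AB KX \<open>down_closed K\<close> by (auto simp: down_closed_def)
    show "U \<subseteq> L"
      unfolding U_def L_def using AB poscomp_refl by (fastforce simp: disjnt_def)
    show "L \<subseteq> V"
      unfolding L_def using AB \<open>down_closed V\<close> by (auto simp: down_closed_def)
  qed
qed

text \<open>The dyadic construction of Urysohn, run with down-closed open sets. Down-closedness of
  all members makes the resulting function \<open>g\<close> monotone, and \<open>1 - g\<close> then
  reverses the order, as membership in \<open>poscomp_hom X unit_op\<close> requires.\<close>

lemma ordered_Urysohn:
  assumes "x \<in> points X" "y \<in> points X" "(x, y) \<notin> pord X"
  obtains p where "p \<in> poscomp_hom X unit_op" "p x < p y"
proof -
  \<comment> \<open>A closed down-closed \<open>K\<close> is interposed in place of the closure of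
    \<open>U\<close>, which need not be down-closed.\<close>
  let ?R = "\<lambda>U V. openin (ptop X) U \<and> openin (ptop X) V \<and> down_closed U \<and> down_closed V \<and>
      (\<exists>K. closedin (ptop X) K \<and> down_closed K \<and> U \<subseteq> K \<and> K \<subseteq> V)"
  let ?D = "dyadics \<inter> {0..1::real}"
  \<comment> \<open>\<open>K\<close> is the down-closure of \<open>y\<close> and \<open>V\<close>
    the complement of the up-closure of \<open>x\<close>; a point of \<open>K\<close> outside
    \<open>V\<close> would put \<open>x\<close> below \<open>y\<close>.\<close>
  define K where "K = {z. \<exists>t\<in>{y}. (z, t) \<in> pord X}"
  define V where "V = points X - {z. \<exists>t\<in>{x}. (t, z) \<in> pord X}"
  have sing: "closedin (ptop X) {t}" if "t \<in> points X" for t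
    using poscomp_Hausdorff_space that by (simp add: closedin_Hausdorff_sing_eq)
  have "closedin (ptop X) K"
    unfolding K_def using sing assms by (intro closedin_down_closure) auto
  moreover have "openin (ptop X) V"
    unfolding V_def using sing assms by (intro openin_diff closedin_up_closure) auto
  moreover have "K \<subseteq> V" "down_closed K" "down_closed V"
    using assms(3) unfolding K_def V_def down_closed_def by (auto dest: poscomp_trans poscomp_ordD)
  ultimately obtain U where "K \<subseteq> U" "?R U V"
    by (metis ordered_normality)
  have "\<exists>G :: real \<Rightarrow> 'a set. G 0 = U \<and> G 1 = V \<and> (\<forall>r\<in>?D. \<forall>s\<in>?D. r < s \<longrightarrow> ?R (G r) (G s))"
  proof (rule recursion_on_dyadic_fractions)
    show "?R U V" by fact
  next
    fix A B assume AB: "?R A B"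
    then obtain L where L: "closedin (ptop X) L" "down_closed L" "A \<subseteq> L" "L \<subseteq> B" by blast
    obtain C M where "openin (ptop X) C" "closedin (ptop X) M" "down_closed C" "down_closed M"
      "L \<subseteq> C" "C \<subseteq> M" "M \<subseteq> B"
      using ordered_normality[of L B] L AB by metis
    then show "\<exists>C. ?R A C \<and> ?R C B"
      using AB L by (intro exI[of _ C]) blast
  next
    fix A B C assume "?R A B" "?R B C"
    then show "?R A C" by (meson subset_trans)
  qed
  then obtain G where G0: "G 0 = U" and G1: "G 1 = V"
    and G: "\<And>r s. r \<in> ?D \<Longrightarrow> s \<in> ?D \<Longrightarrow> r < s \<Longrightarrow> ?R (G r) (G s)"
    by blast
  have D01: "0 \<in> ?D" "1 \<in> ?D" by (force simp: dyadics_def)+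
  have open_G: "openin (ptop X) (G r)" and down_G: "down_closed (G r)" if "r \<in> ?D" for r
    using G[of r 1] G[of 0 r] that D01 by (cases "r = 1"; force)+
  \<comment> \<open>Inserting 1 gives this value to points that lie in no \<open>G r\<close> and
    keeps the set nonempty.\<close>
  define g where "g z = Inf (insert 1 {r \<in> ?D. z \<in> G r})" for z
  have bdd: "bdd_below (insert 1 {r \<in> ?D. z \<in> G r})" for z
    by (auto intro!: bdd_belowI[of _ 0])
  have g01: "0 \<le> g z" "g z \<le> 1" for z
    unfolding g_def using bdd by (auto intro!: cInf_greatest cInf_lower)
  have g_le: "g z \<le> r" if "r \<in> ?D" "z \<in> G r" for r z
    unfolding g_def using that bdd by (auto intro!: cInf_lower)
  have G_mono: "G r \<subseteq> G s" if "r \<in> ?D" "s \<in> ?D" "r \<le> s" for r s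
    using G[OF that(1,2)] that by (cases "r = s") (auto dest: order_trans)
  have le_g: "r \<le> g z" if "r \<in> ?D" "z \<notin> G r" for r z
    unfolding g_def
  proof (rule cInf_greatest)
    fix s assume "s \<in> insert 1 {r \<in> ?D. z \<in> G r}"
    then show "r \<le> s" using that G_mono[of s r] by (cases "s \<le> r") auto
  qed simp
  have "g y \<le> 0"
    using \<open>K \<subseteq> U\<close> poscomp_refl assms(2) G0 D01 by (intro g_le) (auto simp: K_def)
  moreover have "1 \<le> g x"
    using poscomp_refl assms(1) G1 D01 by (intro le_g) (auto simp: V_def)
  ultimately have gxy: "g y < g x" by simp
  have g_mono: "g z \<le> g w" if "(z, w) \<in> pord X" for z w
  proof (rule ccontr)
    assume "\<not> g z \<le> g w"
    then obtain r where "r \<in> ?D" "g w < r" "r < g z"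
      using dyadic_between[of "g w" "g z"] g01 by (metis not_le)
    then show False
      using le_g[of r w] g_le[of r z] down_G[of r] that by (fastforce simp: down_closed_def)
  qed
  have "openin (ptop X) {z \<in> points X. g z < a}" for a
  proof (subst openin_subopen, safe)
    fix z assume z: "z \<in> points X" "g z < a"
    show "\<exists>A. openin (ptop X) A \<and> z \<in> A \<and> A \<subseteq> {z \<in> points X. g z < a}"
    proof (cases "a > 1")
      case True
      then show ?thesis using z g01(2) by (intro exI[of _ "points X"]) (auto intro: le_less_trans)
    next
      case False
      then obtain r where r: "r \<in> ?D" "g z < r" "r < a"
        using dyadic_between[of "g z" a] g01 z by (metis not_le)
      then show ?thesis
        using open_G[of r] le_g[of r z] g_le[of r] z openin_subset[OF open_G[of r]]
        by (intro exI[of _ "G r"]) force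
    qed
  qed
  moreover have "openin (ptop X) {z \<in> points X. g z > a}" for a
  proof (subst openin_subopen, safe)
    fix z assume z: "z \<in> points X" "g z > a"
    show "\<exists>A. openin (ptop X) A \<and> z \<in> A \<and> A \<subseteq> {z \<in> points X. g z > a}"
    proof (cases "a < 0")
      case True
      then show ?thesis using z g01(1) by (intro exI[of _ "points X"]) (auto intro: less_le_trans)
    next
      case False
      then obtain r where r: "r \<in> ?D" "a < r" "r < g z"
        using dyadic_between[of a "g z"] g01 z by (metis not_le)
      \<comment> \<open>A second index \<open>s\<close> is needed because the sets
        \<open>G r\<close> are open: the complement of a closed set between \<open>G r\<close> and
        \<open>G s\<close> is a neighbourhood of \<open>z\<close> on which \<open>g\<close> is at
        least \<open>r\<close>.\<close>
      then obtain s where s: "s \<in> ?D" "r < s" "s < g z"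
        using dyadic_between[of r "g z"] g01 by auto
      obtain L where L: "closedin (ptop X) L" "G r \<subseteq> L" "L \<subseteq> G s"
        using G[of r s] r s by blast
      have "z \<in> points X - L"
        using g_le[of s z] s L z by force
      moreover have "points X - L \<subseteq> {z \<in> points X. g z > a}"
        using le_g[of r] r L by force
      ultimately show ?thesis using L by blast
    qed
  qed
  ultimately have "continuous_map (ptop X) euclideanreal g"
    by (simp add: continuous_map_upper_lower_semicontinuous_lt)
  then have "continuous_map (ptop X) (top_of_set {0..1}) (\<lambda>z\<in>points X. 1 - g z)"
    using g01 by (auto simp: continuous_map_in_subtopology intro!: continuous_intros
        intro: continuous_map_eq[where f="\<lambda>z. 1 - g z"])
  then show thesis
    using gxy assms g_mono
    by (intro that[of "\<lambda>z\<in>points X. 1 - g z"])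
      (auto simp: poscomp_hom_def unit_op_def monotone_on_def g01)
qed

end

section \<open>Lower bounds in the unit interval, weighted colimits and tensors\<close>

lemma unit_eq_if_le_iff:
  fixes a b :: real
  assumes "a \<in> {0..1}" "b \<in> {0..1}" "\<And>v. v \<in> {0..1} \<Longrightarrow> v \<le> a \<longleftrightarrow> v \<le> b"
  shows "a = b"
  using assms(1,2) assms(3)[of a] assms(3)[of b] by auto

lemma uInf_image_mem: "(\<And>i. i \<in> A \<Longrightarrow> f i \<in> {0..1}) \<Longrightarrow> uInf (f ` A) \<in> {0..1}"
  unfolding uInf_def by (auto intro!: cInf_greatest cInf_lower bdd_belowI[of _ 0])

lemma le_uInf_image_iff:
  assumes "\<And>i. i \<in> A \<Longrightarrow> f i \<in> {0..1}" "v \<le> 1"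
  shows "v \<le> uInf (f ` A) \<longleftrightarrow> (\<forall>i\<in>A. v \<le> f i)"
  unfolding uInf_def using assms by (subst le_cInf_iff) (auto intro!: bdd_belowI[of _ 0])

lemma ihom_eqI:
  assumes "H \<in> {0..1}" "\<And>v. v \<in> {0..1} \<Longrightarrow> T u v \<le> w \<longleftrightarrow> v \<le> H"
  shows "ihom T u w = H"
proof -
  have "{v \<in> {0..1}. T u v \<le> w} = {0..H}" using assms by auto
  then show ?thesis using assms(1) by (simp add: ihom_def)
qed

text \<open>Two colimits have equal homs into every object; evaluating these at the two colimits
  themselves gives hom value 1 both ways, and separation applies.\<close>

lemma wcolimit_unique:
  assumes "wcolimit T X a I h w z" "wcolimit T X a I h w z'" "ucat T X a" "useparated X a"
  shows "z = z'"
proof -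
  have "a z z' = a z' z'" "a z' z = a z z" "z \<in> X" "z' \<in> X"
    using assms(1,2) by (auto simp: wcolimit_def)
  then show ?thesis using assms(3,4) by (auto simp: ucat_def useparated_def)
qed

lemma Max_insert_zero_image_insert:
  fixes f :: "'i \<Rightarrow> real"
  assumes "finite I"
  shows "Max (insert 0 (f ` insert i I)) = max (f i) (Max (insert 0 (f ` I)))"
  using assms by (simp add: insert_commute[of 0])

lemma poscomp_hom_unit_op_iff:
  assumes "poscomp X"
  shows "p \<in> poscomp_hom X unit_op \<longleftrightarrow>
    p \<in> extensional (points X) \<and> continuous_map (ptop X) euclideanreal p \<and>
    (\<forall>x\<in>points X. p x \<in> {0..1}) \<and> (\<forall>x y. (x, y) \<in> pord X \<longrightarrow> p y \<le> p x)"
  using poscomp_ordD[OF assms]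
  by (fastforce simp: poscomp_hom_def unit_op_def monotone_on_def continuous_map_in_subtopology Pi_iff)

lemma poscomp_hom_unit_op_compose:
  assumes "poscomp X" "p \<in> poscomp_hom X unit_op" "continuous_on {0..1} k"
    "\<And>u. u \<in> {0..1} \<Longrightarrow> k u \<in> {0..1}"
    "\<And>u v. u \<in> {0..1} \<Longrightarrow> v \<in> {0..1} \<Longrightarrow> u \<le> v \<Longrightarrow> k u \<le> k v"
  shows "(\<lambda>x\<in>points X. k (p x)) \<in> poscomp_hom X unit_op"
proof -
  note p = assms(2)[unfolded poscomp_hom_unit_op_iff[OF assms(1)]]
  have "continuous_map (ptop X) (top_of_set {0..1}) p"
    using p by (auto simp: continuous_map_in_subtopology)
  then have "continuous_map (ptop X) euclideanreal (k \<circ> p)"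
    using assms(3) by (intro continuous_map_compose) auto
  then have "continuous_map (ptop X) euclideanreal (\<lambda>x\<in>points X. k (p x))"
    by (rule continuous_map_eq) auto
  then show ?thesis
    using p assms poscomp_ordD[OF assms(1)] by (fastforce simp: poscomp_hom_unit_op_iff[OF assms(1)])
qed

text \<open>What the two tensors have in common. Cancellation is asked only for positive products,
  since the Lukasiewicz truncation destroys it at 0, and continuity of \<open>ihom\<close> only in
  its second argument, since for multiplication joint continuity fails at (0, 0).
  \<open>T_archimedean\<close> says that the powers of any \<open>u < 1\<close> become arbitrarily
  small.\<close>

locale tensor =
  fixes T :: "real \<Rightarrow> real \<Rightarrow> real"
  assumes T_mem: "u \<in> {0..1} \<Longrightarrow> v \<in> {0..1} \<Longrightarrow> T u v \<in> {0..1}"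
    and T_commute: "u \<in> {0..1} \<Longrightarrow> v \<in> {0..1} \<Longrightarrow> T u v = T v u"
    and T_assoc: "u \<in> {0..1} \<Longrightarrow> v \<in> {0..1} \<Longrightarrow> w \<in> {0..1} \<Longrightarrow> T (T u v) w = T u (T v w)"
    and T_one_right: "u \<in> {0..1} \<Longrightarrow> T u 1 = u"
    and T_mono_right: "u \<in> {0..1} \<Longrightarrow> v \<in> {0..1} \<Longrightarrow> w \<in> {0..1} \<Longrightarrow> v \<le> w \<Longrightarrow> T u v \<le> T u w"
    and T_continuous: "continuous_on ({0..1} \<times> {0..1}) (\<lambda>(u, v). T u v)"
    and ihom_mem: "u \<in> {0..1} \<Longrightarrow> w \<in> {0..1} \<Longrightarrow> ihom T u w \<in> {0..1}"
    and T_le_iff: "u \<in> {0..1} \<Longrightarrow> v \<in> {0..1} \<Longrightarrow> w \<in> {0..1} \<Longrightarrow> T u v \<le> w \<longleftrightarrow> v \<le> ihom T u w"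
    and ihom_continuous: "u \<in> {0..1} \<Longrightarrow> continuous_on {0..1} (ihom T u)"
    and T_archimedean: "u \<in> {0..1} \<Longrightarrow> 0 < c \<Longrightarrow> (\<And>n. c \<le> (T u ^^ n) 1) \<Longrightarrow> u = 1"
    and T_cancel: "u \<in> {0..1} \<Longrightarrow> v \<in> {0..1} \<Longrightarrow> w \<in> {0..1} \<Longrightarrow> 0 < T u w \<Longrightarrow> T u w \<le> T v w \<Longrightarrow> u \<le> v"
    and T_pos_below_one: "u \<in> {0..1} \<Longrightarrow> 0 < u \<Longrightarrow> \<exists>a\<in>{0..<1}. 0 < T u a"
begin

lemma T_zero_right: "u \<in> {0..1} \<Longrightarrow> T u 0 = 0"
  using T_mono_right[of 0 u 1] T_commute[of u 0] T_one_right[of 0] T_mem[of u 0] by auto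

lemma T_zero_left: "u \<in> {0..1} \<Longrightarrow> T 0 u = 0"
  using T_zero_right T_commute[of u 0] by auto

lemma T_one_left: "u \<in> {0..1} \<Longrightarrow> T 1 u = u"
  using T_one_right T_commute[of u 1] by auto

lemma T_mono: "u \<in> {0..1} \<Longrightarrow> v \<in> {0..1} \<Longrightarrow> u' \<in> {0..1} \<Longrightarrow> v' \<in> {0..1} \<Longrightarrow> u \<le> u' \<Longrightarrow> v \<le> v' \<Longrightarrow>
    T u v \<le> T u' v'"
  using T_mono_right[of u v v'] T_mono_right[of v' u u'] T_commute[of u v'] T_commute[of u' v'] by simp

lemma T_le_left: "u \<in> {0..1} \<Longrightarrow> v \<in> {0..1} \<Longrightarrow> T u v \<le> u"
  using T_mono_right[of u v 1] T_one_right by auto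

lemma T_le_right: "u \<in> {0..1} \<Longrightarrow> v \<in> {0..1} \<Longrightarrow> T u v \<le> v"
  using T_le_left[of v u] T_commute by auto

lemma ihom_mono: "u \<in> {0..1} \<Longrightarrow> v \<in> {0..1} \<Longrightarrow> w \<in> {0..1} \<Longrightarrow> v \<le> w \<Longrightarrow> ihom T u v \<le> ihom T u w"
  using T_le_iff[of u "ihom T u v" v] T_le_iff[of u "ihom T u v" w] ihom_mem[of u v] by simp

lemma ihom_eq_one_iff: "u \<in> {0..1} \<Longrightarrow> v \<in> {0..1} \<Longrightarrow> ihom T u v = 1 \<longleftrightarrow> u \<le> v"
  using T_le_iff[of u 1 v] ihom_mem[of u v] T_one_right[of u] by auto

text \<open>Monotonicity makes \<open>T u\<close> commute with binary maxima. Inserting 0 gives the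
  empty maximum the value 0, which \<open>T u\<close> preserves. Membership is carried along because
  the induction step needs it.\<close>

lemma T_Max_zero:
  assumes "finite I" "u \<in> {0..1}" "\<And>i. i \<in> I \<Longrightarrow> f i \<in> {0..1}"
  shows "Max (insert 0 (f ` I)) \<in> {0..1} \<and>
    T u (Max (insert 0 (f ` I))) = Max (insert 0 ((\<lambda>i. T u (f i)) ` I))"
  using assms
proof (induction I rule: finite_induct)
  case empty
  then show ?case by (simp add: T_zero_right)
next
  case (insert i I)
  let ?m = "Max (insert 0 (f ` I))"
  have IH: "?m \<in> {0..1}" "T u ?m = Max (insert 0 ((\<lambda>i. T u (f i)) ` I))"
    using insert by auto
  have fi: "f i \<in> {0..1}" using insert by auto
  have "T u (max (f i) ?m) = max (T u (f i)) (T u ?m)"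
    using T_mono_right[OF insert.prems(1) fi IH(1)] T_mono_right[OF insert.prems(1) IH(1) fi]
    by (auto simp: max_def)
  then show ?case
    unfolding Max_insert_zero_image_insert[OF insert.hyps(1)] using IH fi by auto
qed

text \<open>The expected colimit of \<open>h\<close> weighted by \<open>w\<close>: a finite supremum
  of copowers, computed pointwise. The inserted 0 is the bottom element, reached for empty
  \<open>I\<close>.\<close>

definition wsup :: "'a pospace \<Rightarrow> 'i set \<Rightarrow> ('i \<Rightarrow> 'a \<Rightarrow> real) \<Rightarrow> ('i \<Rightarrow> real) \<Rightarrow> 'a \<Rightarrow> real" where
  "wsup X I h w = (\<lambda>x\<in>points X. Max (insert 0 ((\<lambda>i. T (h i x) (w i)) ` I)))"

section \<open>The enriched category \<open>CX\<close> and its finite colimits\<close>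

context
  fixes X :: "'a pospace"
  assumes X: "poscomp X"
begin

abbreviation "CX \<equiv> poscomp_hom X unit_op"
abbreviation "dX \<equiv> uhom (C_obj T X)"

lemma C_mem: "p \<in> CX \<Longrightarrow> x \<in> points X \<Longrightarrow> p x \<in> {0..1}"
  using poscomp_hom_unit_op_iff[OF X] by auto

lemma C_continuous: "p \<in> CX \<Longrightarrow> continuous_map (ptop X) euclideanreal p"
  using poscomp_hom_unit_op_iff[OF X] by auto

lemma C_antimono: "p \<in> CX \<Longrightarrow> (x, y) \<in> pord X \<Longrightarrow> p y \<le> p x"
  using poscomp_hom_unit_op_iff[OF X] by auto

lemma C_eqI: "p \<in> CX \<Longrightarrow> q \<in> CX \<Longrightarrow> (\<And>x. x \<in> points X \<Longrightarrow> p x = q x) \<Longrightarrow> p = q"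
  unfolding poscomp_hom_unit_op_iff[OF X] by (meson extensionalityI)

lemma C_const: "u \<in> {0..1} \<Longrightarrow> (\<lambda>x\<in>points X. u) \<in> CX"
  using poscomp_ordD[OF X] unfolding poscomp_hom_unit_op_iff[OF X]
  by (auto intro: continuous_map_eq[where f="\<lambda>_. u"])

lemma C_ihom: "p \<in> CX \<Longrightarrow> u \<in> {0..1} \<Longrightarrow> (\<lambda>x\<in>points X. ihom T u (p x)) \<in> CX"
  using X ihom_continuous ihom_mem ihom_mono by (intro poscomp_hom_unit_op_compose) auto

lemma C_tensor:
  assumes "p \<in> CX" "q \<in> CX"
  shows "(\<lambda>x\<in>points X. T (p x) (q x)) \<in> CX"
proof -
  have "continuous_map (ptop X) (prod_topology euclideanreal euclideanreal) (\<lambda>x. (p x, q x))"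
    using assms unfolding poscomp_hom_unit_op_iff[OF X] by (intro continuous_map_pairedI) auto
  \<comment> \<open>\<open>T\<close> is known to be continuous on the unit square only, so the pair
    is first corestricted to it.\<close>
  then have "continuous_map (ptop X) (top_of_set ({0..1} \<times> {0..1})) (\<lambda>x. (p x, q x))"
    using assms C_mem by (simp add: continuous_map_in_subtopology euclidean_product_topology Pi_iff
        del: atLeastAtMost_iff)
  from continuous_map_compose[OF this, of euclideanreal "\<lambda>(u, v). T u v"] T_continuous
  have "continuous_map (ptop X) euclideanreal ((\<lambda>(u, v). T u v) \<circ> (\<lambda>x. (p x, q x)))"
    by simp
  then have "continuous_map (ptop X) euclideanreal (\<lambda>x\<in>points X. T (p x) (q x))"
    by (rule continuous_map_eq) auto
  moreover have "T (p y) (q y) \<le> T (p x) (q x)" if "(x, y) \<in> pord X" for x y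
    using that assms C_mem C_antimono poscomp_ordD[OF X that] by (intro T_mono) auto
  ultimately show ?thesis
    using assms C_mem T_mem poscomp_ordD[OF X] unfolding poscomp_hom_unit_op_iff[OF X] by fastforce
qed

lemma C_max:
  assumes "p \<in> CX" "q \<in> CX"
  shows "(\<lambda>x\<in>points X. max (p x) (q x)) \<in> CX"
proof -
  have "continuous_map (ptop X) euclideanreal (\<lambda>x\<in>points X. max (p x) (q x))"
    using assms unfolding poscomp_hom_unit_op_iff[OF X]
    by (auto intro: continuous_map_eq[OF continuous_map_real_max[of "ptop X" p q]])
  moreover have "max (p y) (q y) \<le> max (p x) (q x)" if "(x, y) \<in> pord X" for x y
    using that assms C_antimono by (intro max.mono) auto
  ultimately show ?thesis
    using assms C_mem poscomp_ordD[OF X] unfolding poscomp_hom_unit_op_iff[OF X]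
    by (simp add: le_max_iff_disj)
qed

lemma C_copower:
  assumes "p \<in> CX" "u \<in> {0..1}"
  shows "(\<lambda>x\<in>points X. T (p x) u) \<in> CX"
proof -
  have "(\<lambda>x\<in>points X. T (p x) u) = (\<lambda>x\<in>points X. T (p x) ((\<lambda>x\<in>points X. u) x))" by auto
  then show ?thesis using C_tensor[OF assms(1) C_const[OF assms(2)]] by simp
qed

lemma C_wsup:
  assumes "finite I" "\<And>i. i \<in> I \<Longrightarrow> h i \<in> CX" "\<And>i. i \<in> I \<Longrightarrow> w i \<in> {0..1}"
  shows "wsup X I h w \<in> CX"
  using assms
proof (induction I rule: finite_induct)
  case empty
  then show ?case using C_const[of 0] by (simp add: wsup_def del: restrict_apply)
next
  case (insert i I)
  have "wsup X (insert i I) h w =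
      (\<lambda>x\<in>points X. max ((\<lambda>x\<in>points X. T (h i x) (w i)) x) (wsup X I h w x))"
    by (rule ext) (simp add: wsup_def Max_insert_zero_image_insert[OF insert.hyps(1)]
        del: image_insert)
  moreover have "(\<lambda>x\<in>points X. T (h i x) (w i)) \<in> CX" "wsup X I h w \<in> CX"
    using C_copower insert by auto
  ultimately show ?case using C_max by metis
qed

lemma C_carrier: "carrier (C_obj T X) = CX"
  by (simp add: C_obj_def)

lemma C_hom_mem: "p \<in> CX \<Longrightarrow> q \<in> CX \<Longrightarrow> dX p q \<in> {0..1}"
  using C_mem ihom_mem by (simp add: C_obj_def uInf_image_mem del: atLeastAtMost_iff)

text \<open>By the adjunction a lower bound on a hom, which is an infimum over the space, becomes a
  pointwise inequality. The enriched identities below are reduced to properties of \<open>T\<close>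
  in this way.\<close>

lemma le_C_hom_iff:
  assumes "p \<in> CX" "q \<in> CX" "v \<in> {0..1}"
  shows "v \<le> dX p q \<longleftrightarrow> (\<forall>x\<in>points X. T (p x) v \<le> q x)"
proof -
  have mem: "ihom T (p x) (q x) \<in> {0..1}" if "x \<in> points X" for x
    using assms C_mem ihom_mem that by blast
  have "dX p q = uInf ((\<lambda>x. ihom T (p x) (q x)) ` points X)"
    by (simp add: C_obj_def)
  then have "v \<le> dX p q \<longleftrightarrow> (\<forall>x\<in>points X. v \<le> ihom T (p x) (q x))"
    using le_uInf_image_iff[of "points X" "\<lambda>x. ihom T (p x) (q x)" v] mem assms(3) by auto
  also have "\<dots> \<longleftrightarrow> (\<forall>x\<in>points X. T (p x) v \<le> q x)"
    using assms C_mem T_le_iff by blast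
  finally show ?thesis .
qed

lemma C_hom_eq_one_iff: "p \<in> CX \<Longrightarrow> q \<in> CX \<Longrightarrow> dX p q = 1 \<longleftrightarrow> (\<forall>x\<in>points X. p x \<le> q x)"
  using le_C_hom_iff[of p q 1] C_hom_mem[of p q] T_one_right[OF C_mem[of p]] by auto

lemma C_ucat: "ucat T CX dX"
proof -
  have "T (dX p q) (dX q r) \<le> dX p r" if "p \<in> CX" "q \<in> CX" "r \<in> CX" for p q r
  proof -
    note mem = C_hom_mem[OF that(1,2)] C_hom_mem[OF that(2,3)]
    have "T (p x) (T (dX p q) (dX q r)) \<le> r x" if x: "x \<in> points X" for x
    proof -
      have px: "p x \<in> {0..1}" "q x \<in> {0..1}"
        using C_mem \<open>p \<in> CX\<close> \<open>q \<in> CX\<close> x by blast+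
      have le: "T (p x) (dX p q) \<le> q x" "T (q x) (dX q r) \<le> r x"
        using le_C_hom_iff[OF \<open>p \<in> CX\<close> \<open>q \<in> CX\<close> mem(1)] le_C_hom_iff[OF \<open>q \<in> CX\<close> \<open>r \<in> CX\<close> mem(2)] x
        by auto
      have "T (p x) (T (dX p q) (dX q r)) = T (T (p x) (dX p q)) (dX q r)"
        using T_assoc px mem by presburger
      also have "\<dots> \<le> T (q x) (dX q r)"
        using px mem le by (intro T_mono T_mem order_refl)
      finally show ?thesis using le by linarith
    qed
    then show ?thesis using le_C_hom_iff[OF that(1,3) T_mem[OF mem]] by blast
  qed
  then show ?thesis using C_hom_mem C_hom_eq_one_iff by (auto simp: ucat_def simp del: atLeastAtMost_iff)
qed

lemma C_useparated: "useparated CX dX"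
  unfolding useparated_def using C_hom_eq_one_iff C_eqI by (meson order_antisym)

lemma Max_zero_T_le_iff:
  assumes "finite I" "\<And>i. i \<in> I \<Longrightarrow> f i \<in> {0..1}" "v \<in> {0..1}" "0 \<le> c"
  shows "T (Max (insert 0 (f ` I))) v \<le> c \<longleftrightarrow> (\<forall>i\<in>I. T (f i) v \<le> c)"
proof -
  note T_Max = T_Max_zero[OF assms(1,3,2)]
  have "T (Max (insert 0 (f ` I))) v = Max (insert 0 ((\<lambda>i. T v (f i)) ` I))"
    using T_Max T_commute[OF conjunct1[OF T_Max] assms(3)] by simp
  also have "(\<lambda>i. T v (f i)) ` I = (\<lambda>i. T (f i) v) ` I"
    using T_commute[OF assms(3) assms(2)] by (rule image_cong[OF refl])
  finally show ?thesis using assms(1,4) by simp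
qed

text \<open>Both homs are shown to have the same lower bounds \<open>v\<close>: the adjunction and
  associativity turn either condition into the same family of inequalities, with the quantifiers
  over the points and over \<open>I\<close> exchanged.\<close>

lemma C_wcolimit_wsup:
  assumes "finite I" "\<And>i. i \<in> I \<Longrightarrow> h i \<in> CX" "\<And>i. i \<in> I \<Longrightarrow> w i \<in> {0..1}"
  shows "wcolimit T CX dX I h w (wsup X I h w)"
proof -
  have ws: "wsup X I h w \<in> CX" using C_wsup assms by blast
  have "dX (wsup X I h w) q = uInf ((\<lambda>i. ihom T (w i) (dX (h i) q)) ` I)" if q: "q \<in> CX" for q
  proof (rule unit_eq_if_le_iff)
    show "dX (wsup X I h w) q \<in> {0..1}" using C_hom_mem ws q by blast
    have mem: "ihom T (w i) (dX (h i) q) \<in> {0..1}" if "i \<in> I" for i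
      using that assms q C_hom_mem ihom_mem by blast
    then show "uInf ((\<lambda>i. ihom T (w i) (dX (h i) q)) ` I) \<in> {0..1}" by (rule uInf_image_mem)
    fix v :: real assume v: "v \<in> {0..1}"
    have "v \<le> dX (wsup X I h w) q \<longleftrightarrow> (\<forall>x\<in>points X. T (wsup X I h w x) v \<le> q x)"
      using le_C_hom_iff ws q v by blast
    also have "\<dots> \<longleftrightarrow> (\<forall>x\<in>points X. \<forall>i\<in>I. T (T (h i x) (w i)) v \<le> q x)"
    proof (intro ball_cong refl)
      fix x assume x: "x \<in> points X"
      have "T (h i x) (w i) \<in> {0..1}" if "i \<in> I" for i
        using T_mem C_mem assms that x by blast
      then show "T (wsup X I h w x) v \<le> q x \<longleftrightarrow> (\<forall>i\<in>I. T (T (h i x) (w i)) v \<le> q x)"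
        using Max_zero_T_le_iff[OF assms(1), of "\<lambda>i. T (h i x) (w i)" v "q x"] v x C_mem[OF q x]
        by (simp add: wsup_def)
    qed
    also have "\<dots> \<longleftrightarrow> (\<forall>i\<in>I. \<forall>x\<in>points X. T (h i x) (T (w i) v) \<le> q x)"
      using T_assoc[OF C_mem _ v] assms by (metis (no_types, lifting))
    also have "\<dots> \<longleftrightarrow> (\<forall>i\<in>I. T (w i) v \<le> dX (h i) q)"
      using le_C_hom_iff[OF _ q T_mem[OF _ v]] assms by (metis (no_types, lifting))
    also have "\<dots> \<longleftrightarrow> (\<forall>i\<in>I. v \<le> ihom T (w i) (dX (h i) q))"
      using assms v q T_le_iff C_hom_mem by blast
    also have "\<dots> \<longleftrightarrow> v \<le> uInf ((\<lambda>i. ihom T (w i) (dX (h i) q)) ` I)"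
      using le_uInf_image_iff[of I "\<lambda>i. ihom T (w i) (dX (h i) q)" v] mem v by simp
    finally show "v \<le> dX (wsup X I h w) q \<longleftrightarrow> v \<le> uInf ((\<lambda>i. ihom T (w i) (dX (h i) q)) ` I)" .
  qed
  then show ?thesis using ws by (simp add: wcolimit_def)
qed

lemma C_pointwise: "C_pointwise T X"
proof -
  have "dX (\<lambda>x\<in>points X. T (p x) u) q = ihom T u (dX p q)"
    if "p \<in> CX" "q \<in> CX" "u \<in> {0..1}" for p q u
  proof (rule unit_eq_if_le_iff)
    show "dX (\<lambda>x\<in>points X. T (p x) u) q \<in> {0..1}" "ihom T u (dX p q) \<in> {0..1}"
      using that C_hom_mem C_copower ihom_mem by blast+
    fix v :: real assume v: "v \<in> {0..1}"
    have "v \<le> dX (\<lambda>x\<in>points X. T (p x) u) q \<longleftrightarrow> (\<forall>x\<in>points X. T (p x) (T u v) \<le> q x)"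
      using le_C_hom_iff[OF C_copower[OF that(1,3)] that(2) v] T_assoc C_mem that v by auto
    also have "\<dots> \<longleftrightarrow> v \<le> ihom T u (dX p q)"
      using le_C_hom_iff[OF that(1,2) T_mem[OF that(3) v]] T_le_iff[OF that(3) v C_hom_mem[OF that(1,2)]]
      by simp
    finally show "v \<le> dX (\<lambda>x\<in>points X. T (p x) u) q \<longleftrightarrow> v \<le> ihom T u (dX p q)" .
  qed
  moreover have zero: "(\<lambda>x\<in>points X. 0) \<in> CX" using C_const[of 0] by simp
  have "ubottom CX dX (\<lambda>x\<in>points X. 0)"
    using zero C_mem by (simp add: ubottom_def C_hom_eq_one_iff)
  moreover have "usup CX dX p q (\<lambda>x\<in>points X. max (p x) (q x))" if "p \<in> CX" "q \<in> CX" for p q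
    using that C_max[OF that] by (simp add: usup_def C_hom_eq_one_iff)
  ultimately show ?thesis
    using C_copower unfolding C_pointwise_def Let_def C_carrier ucopower_def by blast
qed

end
end

section \<open>\<open>CX\<close> as a monoid, and functoriality of \<open>C\<close>\<close>

context tensor
begin

lemma C_one: "\<one>\<^bsub>C_obj T X\<^esub> = (\<lambda>x\<in>points X. 1)"
  by (simp add: C_obj_def)

lemma C_mult: "p \<otimes>\<^bsub>C_obj T X\<^esub> q = (\<lambda>x\<in>points X. T (p x) (q x))"
  by (simp add: C_obj_def)

lemma C_one_mem: "poscomp X \<Longrightarrow> \<one>\<^bsub>C_obj T X\<^esub> \<in> CX X"
  using C_const[of X 1] by (simp add: C_one)

lemma C_mult_mem: "poscomp X \<Longrightarrow> p \<in> CX X \<Longrightarrow> q \<in> CX X \<Longrightarrow> p \<otimes>\<^bsub>C_obj T X\<^esub> q \<in> CX X"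
  using C_tensor by (simp only: C_mult)

lemma wdiagram_in: "wdiagram T A a I d h w \<Longrightarrow> i \<in> I \<Longrightarrow> h i \<in> A \<and> w i \<in> {0..1}"
  by (auto simp: wdiagram_def ufunctor_def)

text \<open>Equips an arbitrary family with a discrete index category, so that cocontinuity can be
  applied to any \<open>h\<close> and \<open>w\<close>.\<close>

lemma discrete_wdiagram:
  assumes "ucat T A a" "\<And>i. i \<in> I \<Longrightarrow> h i \<in> A" "\<And>i. i \<in> I \<Longrightarrow> w i \<in> {0..1}"
  shows "wdiagram T A a I (\<lambda>i j. if i = j then 1 else 0) h w"
  using assms T_zero_left T_one_left T_zero_right T_mem[of 1 1]
  by (force simp: wdiagram_def ucat_def ufunctor_def)

text \<open>Finite colimits in \<open>CY\<close> are unique and given by \<open>wsup\<close>, so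
  preserving them amounts to an equation between pointwise formulas.\<close>

lemma fin_cocontinuous_C_iff:
  assumes X: "poscomp X" and Y: "poscomp Y"
  shows "fin_cocontinuous T (CX Y) (dX Y) (CX X) (dX X) F \<longleftrightarrow>
    ufunctor (CX Y) (dX Y) (CX X) (dX X) F \<and>
    (\<forall>(I :: nat set) h w. finite I \<and> (\<forall>i\<in>I. h i \<in> CX Y \<and> w i \<in> {0..1}) \<longrightarrow>
      F (wsup Y I h w) = wsup X I (F \<circ> h) w)"
    (is "?l \<longleftrightarrow> ?r")
proof
  assume L: ?l
  then have F: "ufunctor (CX Y) (dX Y) (CX X) (dX X) F" by (simp add: fin_cocontinuous_def)
  have "F (wsup Y I h w) = wsup X I (F \<circ> h) w"
    if "finite I" "\<forall>i\<in>I. h i \<in> CX Y \<and> w i \<in> {0..1}" for I :: "nat set" and h w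
  proof (rule wcolimit_unique)
    have "wdiagram T (CX Y) (dX Y) I (\<lambda>i j. if i = j then 1 else 0) h w"
      using that by (intro discrete_wdiagram C_ucat[OF Y]) simp_all
    moreover have "wcolimit T (CX Y) (dX Y) I h w (wsup Y I h w)"
      using that by (intro C_wcolimit_wsup[OF Y]) simp_all
    ultimately show "wcolimit T (CX X) (dX X) I (F \<circ> h) w (F (wsup Y I h w))"
      using L that(1) unfolding fin_cocontinuous_def by metis
    show "wcolimit T (CX X) (dX X) I (F \<circ> h) w (wsup X I (F \<circ> h) w)"
      using that F by (intro C_wcolimit_wsup[OF X]) (auto simp: ufunctor_def)
  qed (rule C_ucat[OF X] C_useparated[OF X])+
  with F show ?r by blast
next
  assume R: ?r
  then have F: "ufunctor (CX Y) (dX Y) (CX X) (dX X) F" by blast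
  have "wcolimit T (CX X) (dX X) I (F \<circ> h) w (F z)"
    if "finite I" "wdiagram T (CX Y) (dX Y) I d h w" "wcolimit T (CX Y) (dX Y) I h w z"
    for I :: "nat set" and d h w z
  proof -
    have h: "\<forall>i\<in>I. h i \<in> CX Y \<and> w i \<in> {0..1}" using wdiagram_in[OF that(2)] by simp
    then have "wcolimit T (CX Y) (dX Y) I h w (wsup Y I h w)"
      using that(1) by (intro C_wcolimit_wsup[OF Y]) simp_all
    then have "z = wsup Y I h w"
      using wcolimit_unique[OF that(3) _ C_ucat[OF Y] C_useparated[OF Y]] by blast
    then have "F z = wsup X I (F \<circ> h) w" using R h that(1) by simp
    moreover have "wcolimit T (CX X) (dX X) I (F \<circ> h) w (wsup X I (F \<circ> h) w)"
      using that(1) h F by (intro C_wcolimit_wsup[OF X]) (auto simp: ufunctor_def)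
    ultimately show ?thesis by simp
  qed
  then show ?l unfolding fin_cocontinuous_def using F by auto
qed

text \<open>The functor inequality follows from transporting a single bound, namely
  \<open>v = dX Y p q\<close>, from the points of \<open>Y\<close> to those of
  \<open>X\<close>.\<close>

lemma C_ufunctorI:
  assumes X: "poscomp X" and Y: "poscomp Y"
    and "\<And>p. p \<in> CX Y \<Longrightarrow> F p \<in> CX X"
    and "\<And>p q v x. \<lbrakk>p \<in> CX Y; q \<in> CX Y; v \<in> {0..1}; x \<in> points X;
      \<And>y. y \<in> points Y \<Longrightarrow> T (p y) v \<le> q y\<rbrakk> \<Longrightarrow> T (F p x) v \<le> F q x"
  shows "ufunctor (CX Y) (dX Y) (CX X) (dX X) F"
proof -
  have "dX Y p q \<le> dX X (F p) (F q)" if "p \<in> CX Y" "q \<in> CX Y" for p q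
  proof (subst le_C_hom_iff[OF X assms(3)[OF that(1)] assms(3)[OF that(2)] C_hom_mem[OF Y that]], rule ballI)
    have "T (p y) (dX Y p q) \<le> q y" if "y \<in> points Y" for y
      using le_C_hom_iff[OF Y \<open>p \<in> CX Y\<close> \<open>q \<in> CX Y\<close> C_hom_mem[OF Y \<open>p \<in> CX Y\<close> \<open>q \<in> CX Y\<close>]] that
      by simp
    then show "T (F p x) (dX Y p q) \<le> F q x" if "x \<in> points X" for x
      using assms(4)[OF \<open>p \<in> CX Y\<close> \<open>q \<in> CX Y\<close> C_hom_mem[OF Y \<open>p \<in> CX Y\<close> \<open>q \<in> CX Y\<close>] that] by simp
  qed
  then show ?thesis using assms(3) by (auto simp: ufunctor_def)
qed

lemma C_comm_monoid:
  assumes X: "poscomp X"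
  shows "comm_monoid (C_obj T X)"
proof (rule comm_monoidI; unfold C_carrier[OF X])
  fix p q r assume "p \<in> CX X" "q \<in> CX X" "r \<in> CX X"
  then have mem: "p x \<in> {0..1}" "q x \<in> {0..1}" "r x \<in> {0..1}" if "x \<in> points X" for x
    using C_mem[OF X] that by blast+
  show "p \<otimes>\<^bsub>C_obj T X\<^esub> q \<otimes>\<^bsub>C_obj T X\<^esub> r = p \<otimes>\<^bsub>C_obj T X\<^esub> (q \<otimes>\<^bsub>C_obj T X\<^esub> r)"
    using T_assoc[OF mem] by (auto simp: C_mult)
next
  fix p q assume "p \<in> CX X" "q \<in> CX X"
  then have mem: "p x \<in> {0..1}" "q x \<in> {0..1}" if "x \<in> points X" for x
    using C_mem[OF X] that by blast+
  show "p \<otimes>\<^bsub>C_obj T X\<^esub> q = q \<otimes>\<^bsub>C_obj T X\<^esub> p"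
    unfolding C_mult using T_commute[OF mem] by (intro restrict_ext)
next
  fix p assume p: "p \<in> CX X"
  show "\<one>\<^bsub>C_obj T X\<^esub> \<otimes>\<^bsub>C_obj T X\<^esub> p = p"
    using T_one_left C_mem[OF X p] by (intro C_eqI[OF X C_mult_mem[OF X C_one_mem[OF X] p] p]) (simp add: C_mult C_one)
qed (simp_all add: X C_one_mem C_mult_mem)

text \<open>Pointwise, \<open>T (p x)\<close> commutes with finite maxima, and associativity moves
  the weights outside.\<close>

lemma C_mult_cocontinuous:
  assumes X: "poscomp X" and p: "p \<in> CX X"
  shows "fin_cocontinuous T (CX X) (dX X) (CX X) (dX X) (\<lambda>q. p \<otimes>\<^bsub>C_obj T X\<^esub> q)"
  unfolding fin_cocontinuous_C_iff[OF X X]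
proof (intro conjI allI impI)
  show "ufunctor (CX X) (dX X) (CX X) (dX X) (\<lambda>q. p \<otimes>\<^bsub>C_obj T X\<^esub> q)"
  proof (rule C_ufunctorI[OF X X])
    fix q r v x assume q: "q \<in> CX X" and r: "r \<in> CX X" and v: "v \<in> {0..1}" and x: "x \<in> points X"
      and le: "\<And>y. y \<in> points X \<Longrightarrow> T (q y) v \<le> r y"
    note mem = C_mem[OF X p x] C_mem[OF X q x] C_mem[OF X r x]
    have "T (T (p x) (q x)) v = T (p x) (T (q x) v)" using T_assoc mem v by blast
    also have "\<dots> \<le> T (p x) (r x)" using mem v le x by (intro T_mono_right T_mem)
    finally show "T ((p \<otimes>\<^bsub>C_obj T X\<^esub> q) x) v \<le> (p \<otimes>\<^bsub>C_obj T X\<^esub> r) x"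
      using x by (simp add: C_mult)
  qed (rule C_mult_mem[OF X p])
next
  fix I :: "nat set" and h and w :: "nat \<Rightarrow> real" assume hw: "finite I \<and> (\<forall>i\<in>I. h i \<in> CX X \<and> w i \<in> {0..1})"
  show "p \<otimes>\<^bsub>C_obj T X\<^esub> wsup X I h w = wsup X I ((\<lambda>q. p \<otimes>\<^bsub>C_obj T X\<^esub> q) \<circ> h) w"
    unfolding C_mult wsup_def
  proof (intro restrict_ext)
    fix x assume x: "x \<in> points X"
    have px: "p x \<in> {0..1}" and hx: "\<And>i. i \<in> I \<Longrightarrow> h i x \<in> {0..1}"
      using C_mem[OF X] p hw x by blast+
    have "T (p x) (Max (insert 0 ((\<lambda>i. T (h i x) (w i)) ` I)))
        = Max (insert 0 ((\<lambda>i. T (p x) (T (h i x) (w i))) ` I))"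
      using hw px hx by (intro conjunct2[OF T_Max_zero] T_mem) simp_all
    also have "(\<lambda>i. T (p x) (T (h i x) (w i))) ` I = (\<lambda>i. T (T (p x) (h i x)) (w i)) ` I"
      using T_assoc[OF px hx] hw by (intro image_cong) auto
    finally show "T (p x) ((\<lambda>x\<in>points X. Max (insert 0 ((\<lambda>i. T (h i x) (w i)) ` I))) x)
        = Max (insert 0 ((\<lambda>i. T (((\<lambda>q. \<lambda>x\<in>points X. T (p x) (q x)) \<circ> h) i x) (w i)) ` I))"
      using x by simp
  qed
qed

lemma C_mon_finsup:
  assumes X: "poscomp X"
  shows "mon_finsup T (C_obj T X)"
proof -
  have "fin_cocomplete T (CX X) (dX X)"
    unfolding fin_cocomplete_def
  proof (intro allI impI)
    fix I :: "nat set" and d h and w :: "nat \<Rightarrow> real" assume "finite I \<and> wdiagram T (CX X) (dX X) I d h w"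
    then show "\<exists>z. wcolimit T (CX X) (dX X) I h w z"
      using wdiagram_in[of "CX X" "dX X" I d h w]
      by (intro exI[of _ "wsup X I h w"] C_wcolimit_wsup[OF X]) simp_all
  qed
  moreover have "utop (CX X) (dX X) \<one>\<^bsub>C_obj T X\<^esub>"
    using C_one_mem[OF X] C_mem[OF X] by (simp add: utop_def C_hom_eq_one_iff[OF X]) (simp add: C_one)
  ultimately show ?thesis
    using C_ucat[OF X] C_useparated[OF X] C_comm_monoid[OF X] C_mult_cocontinuous[OF X]
    by (simp add: mon_finsup_def finsup_def C_carrier[OF X])
qed

lemma C_map_apply: "p \<in> CX Y \<Longrightarrow> x \<in> points X \<Longrightarrow> C_map X Y f p x = p (f x)"
  by (simp add: C_map_def compose_def)

lemma poscomp_hom_compose: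
  assumes "f \<in> poscomp_hom X Y" "g \<in> poscomp_hom Y Z"
  shows "compose (points X) g f \<in> poscomp_hom X Z"
proof -
  have "continuous_map (ptop X) (ptop Z) (compose (points X) g f)"
    using assms by (auto simp: poscomp_hom_def compose_def intro: continuous_map_eq[OF continuous_map_compose])
  moreover have "f x \<in> points Y" if "x \<in> points X" for x
    using assms(1) that by (auto simp: poscomp_hom_def continuous_map_def)
  ultimately show ?thesis
    using assms by (auto simp: poscomp_hom_def monotone_on_def compose_def)
qed

lemma C_map_mem: "f \<in> poscomp_hom X Y \<Longrightarrow> p \<in> CX Y \<Longrightarrow> C_map X Y f p \<in> CX X"
  using poscomp_hom_compose by (simp add: C_map_def)

text \<open>All operations are pointwise, so precomposition preserves them; homs can only grow,
  since a bound valid on all of \<open>Y\<close> holds in particular on the image of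
  \<open>f\<close>.\<close>

lemma C_map_hom:
  assumes X: "poscomp X" and Y: "poscomp Y" and f: "f \<in> poscomp_hom X Y"
  shows "C_map X Y f \<in> mon_finsup_hom T (C_obj T Y) (C_obj T X)"
proof -
  have fx: "f x \<in> points Y" if "x \<in> points X" for x
    using f that by (auto simp: poscomp_hom_def continuous_map_def)
  have "C_map X Y f (p \<otimes>\<^bsub>C_obj T Y\<^esub> q) = C_map X Y f p \<otimes>\<^bsub>C_obj T X\<^esub> C_map X Y f q"
    if "p \<in> CX Y" "q \<in> CX Y" for p q
  proof (rule C_eqI[OF X])
    fix x assume x: "x \<in> points X"
    then show "C_map X Y f (p \<otimes>\<^bsub>C_obj T Y\<^esub> q) x = (C_map X Y f p \<otimes>\<^bsub>C_obj T X\<^esub> C_map X Y f q) x"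
      using C_map_apply[OF C_mult_mem[OF Y that] x] C_map_apply[OF that(1) x]
        C_map_apply[OF that(2) x] fx
      by (simp add: C_mult)
  qed (use that f X Y in \<open>simp_all add: C_map_mem C_mult_mem\<close>)
  then have "C_map X Y f \<in> hom (C_obj T Y) (C_obj T X)"
    using f by (simp add: hom_def C_carrier[OF X] C_carrier[OF Y] C_map_mem)
  moreover have "C_map X Y f \<one>\<^bsub>C_obj T Y\<^esub> = \<one>\<^bsub>C_obj T X\<^esub>"
  proof (rule C_eqI[OF X])
    fix x assume x: "x \<in> points X"
    then show "C_map X Y f \<one>\<^bsub>C_obj T Y\<^esub> x = \<one>\<^bsub>C_obj T X\<^esub> x"
      using C_map_apply[OF C_one_mem[OF Y] x] fx by (simp add: C_one)
  qed (use f X Y in \<open>simp_all add: C_map_mem C_one_mem\<close>)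
  moreover have "C_map X Y f \<in> extensional (CX Y)" by (simp add: C_map_def)
  moreover have "ufunctor (CX Y) (dX Y) (CX X) (dX X) (C_map X Y f)"
    using fx by (intro C_ufunctorI[OF X Y C_map_mem[OF f]]) (simp_all add: C_map_apply)
  moreover have "C_map X Y f (wsup Y I h w) = wsup X I (C_map X Y f \<circ> h) w"
    if hw: "finite I" "\<forall>i\<in>I. h i \<in> CX Y \<and> w i \<in> {0..1}" for I :: "nat set" and h w
  proof (rule C_eqI[OF X])
    have ws: "wsup Y I h w \<in> CX Y" using C_wsup[OF Y] hw by blast
    then show "C_map X Y f (wsup Y I h w) \<in> CX X" by (rule C_map_mem[OF f])
    show "wsup X I (C_map X Y f \<circ> h) w \<in> CX X"
      using hw f by (intro C_wsup[OF X]) (simp_all add: C_map_mem)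
    fix x assume x: "x \<in> points X"
    then have "(\<lambda>i. T ((C_map X Y f \<circ> h) i x) (w i)) ` I = (\<lambda>i. T (h i (f x)) (w i)) ` I"
      using hw by (intro image_cong) (simp_all add: C_map_apply)
    then show "C_map X Y f (wsup Y I h w) x = wsup X I (C_map X Y f \<circ> h) w x"
      using C_map_apply[OF ws x] x fx by (simp add: wsup_def)
  qed
  ultimately show ?thesis
    by (simp add: mon_finsup_hom_def C_carrier[OF X] C_carrier[OF Y] fin_cocontinuous_C_iff[OF X Y])
qed

end

section \<open>Characters of \<open>CY\<close> are evaluations\<close>

text \<open>The properties that \<open>F p x\<close> has as a function of \<open>p\<close>, for a
  morphism \<open>F\<close> and a fixed point \<open>x\<close>. \<open>char_wsup\<close> comprises
  preservation of bottom, binary suprema and copowers, as the cases of no index, two indices of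
  weight 1, and one index.\<close>

locale character = tensor +
  fixes Y :: "'a pospace" and \<phi> :: "('a \<Rightarrow> real) \<Rightarrow> real"
  assumes Y: "poscomp Y"
    and char_mem: "p \<in> CX Y \<Longrightarrow> \<phi> p \<in> {0..1}"
    and char_mono: "p \<in> CX Y \<Longrightarrow> q \<in> CX Y \<Longrightarrow> (\<And>y. y \<in> points Y \<Longrightarrow> p y \<le> q y) \<Longrightarrow> \<phi> p \<le> \<phi> q"
    and char_one: "\<phi> \<one>\<^bsub>C_obj T Y\<^esub> = 1"
    and char_mult: "p \<in> CX Y \<Longrightarrow> q \<in> CX Y \<Longrightarrow> \<phi> (p \<otimes>\<^bsub>C_obj T Y\<^esub> q) = T (\<phi> p) (\<phi> q)"
    and char_wsup: "finite (I :: nat set) \<Longrightarrow> (\<And>i. i \<in> I \<Longrightarrow> h i \<in> CX Y) \<Longrightarrow>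
      (\<And>i. i \<in> I \<Longrightarrow> w i \<in> {0..1}) \<Longrightarrow>
      \<phi> (wsup Y I h w) = Max (insert 0 ((\<lambda>i. T (\<phi> (h i)) (w i)) ` I))"
begin

lemma char_copower:
  assumes "p \<in> CX Y" "u \<in> {0..1}"
  shows "\<phi> (\<lambda>y\<in>points Y. T (p y) u) = T (\<phi> p) u"
proof -
  have "wsup Y {0::nat} (\<lambda>_. p) (\<lambda>_. u) = (\<lambda>y\<in>points Y. T (p y) u)"
    unfolding wsup_def
  proof (rule restrict_ext)
    fix y assume "y \<in> points Y"
    then have "0 \<le> T (p y) u" using T_mem[OF C_mem[OF Y assms(1)] assms(2)] by simp
    then show "Max (insert 0 ((\<lambda>i. T (p y) u) ` {0::nat})) = T (p y) u" by simp
  qed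
  moreover have "0 \<le> T (\<phi> p) u" using T_mem[OF char_mem[OF assms(1)] assms(2)] by simp
  ultimately show ?thesis
    using char_wsup[of "{0}" "\<lambda>_. p" "\<lambda>_. u"] assms by simp
qed

lemma char_const: "u \<in> {0..1} \<Longrightarrow> \<phi> (\<lambda>y\<in>points Y. u) = u"
proof -
  assume u: "u \<in> {0..1}"
  have "(\<lambda>y\<in>points Y. T (\<one>\<^bsub>C_obj T Y\<^esub> y) u) = (\<lambda>y\<in>points Y. u)"
    using T_one_left[OF u] by (intro restrict_ext) (simp add: C_one)
  then show ?thesis
    using char_copower[OF C_one_mem[OF Y] u] char_one T_one_left[OF u] by simp
qed

text \<open>Otherwise finitely many of the sets where \<open>p y < T (q y) u\<close> cover the space, and
  \<open>p\<close> is dominated by a finite supremum whose \<open>\<phi>\<close>-value is less than \<open>\<phi> p\<close>.\<close>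

lemma char_dominating_point:
  assumes p: "p \<in> CX Y" and pos: "0 < \<phi> p"
  obtains y where "y \<in> points Y"
    "\<And>q u. q \<in> CX Y \<Longrightarrow> u \<in> {0..1} \<Longrightarrow> p y < T (q y) u \<Longrightarrow> \<phi> p \<le> T (\<phi> q) u"
proof -
  have "\<exists>y\<in>points Y. \<forall>q\<in>CX Y. \<forall>u\<in>{0..1}. p y < T (q y) u \<longrightarrow> \<phi> p \<le> T (\<phi> q) u"
  proof (rule ccontr)
    assume "\<not> ?thesis"
    then have "\<forall>y\<in>points Y. \<exists>q u. q \<in> CX Y \<and> u \<in> {0..1} \<and> p y < T (q y) u \<and> T (\<phi> q) u < \<phi> p"
      by (meson not_le)
    then obtain Q U where QU: "\<And>y. y \<in> points Y \<Longrightarrow>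
        Q y \<in> CX Y \<and> U y \<in> {0..1} \<and> p y < T (Q y y) (U y) \<and> T (\<phi> (Q y)) (U y) < \<phi> p"
      by metis
    define N where "N y = {z \<in> points Y. p z < T (Q y z) (U y)}" for y
    have "openin (ptop Y) (N y)" if "y \<in> points Y" for y
    proof -
      have "(\<lambda>z\<in>points Y. T (Q y z) (U y)) \<in> CX Y"
        using QU[OF that] C_copower[OF Y] by blast
      then have "continuous_map (ptop Y) euclideanreal (\<lambda>z. (\<lambda>z\<in>points Y. T (Q y z) (U y)) z - p z)"
        using p by (intro continuous_map_diff C_continuous[OF Y])
      then have "openin (ptop Y) {z \<in> points Y. (\<lambda>z\<in>points Y. T (Q y z) (U y)) z - p z \<in> {0<..}}"
        by (rule openin_continuous_map_preimage) simp
      moreover have "{z \<in> points Y. (\<lambda>z\<in>points Y. T (Q y z) (U y)) z - p z \<in> {0<..}} = N y"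
        unfolding N_def by auto
      ultimately show ?thesis by simp
    qed
    moreover have "points Y \<subseteq> \<Union> (N ` points Y)"
      using QU by (auto simp: N_def)
    ultimately obtain \<F> where "finite \<F>" "\<F> \<subseteq> N ` points Y" "points Y \<subseteq> \<Union> \<F>"
      using Y unfolding poscomp_def compact_space_alt by (metis (no_types, lifting) imageE)
    then obtain S where S: "finite S" "S \<subseteq> points Y" "points Y \<subseteq> \<Union> (N ` S)"
      using finite_subset_image by metis
    \<comment> \<open>The finite subcover is re-indexed by naturals because \<open>char_wsup\<close>
      speaks of index sets of type \<open>nat\<close>.\<close>
    then obtain n :: nat and e where e: "S = e ` {i. i < n}"
      using finite_imp_nat_seg_image_inj_on by metis
    let ?I = "{i. i < n}"
    have eS: "e i \<in> points Y" if "i \<in> ?I" for i using e S that by auto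
    define m where "m = wsup Y ?I (Q \<circ> e) (U \<circ> e)"
    have QUe: "(Q \<circ> e) i \<in> CX Y" "(U \<circ> e) i \<in> {0..1}" "T (\<phi> ((Q \<circ> e) i)) ((U \<circ> e) i) < \<phi> p"
      if "i \<in> ?I" for i
      using QU[OF eS[OF that]] by simp_all
    have m: "m \<in> CX Y" unfolding m_def using QUe by (intro C_wsup[OF Y]) simp_all
    have "p y \<le> m y" if y: "y \<in> points Y" for y
    proof -
      obtain i where i: "i \<in> ?I" "y \<in> N (e i)" using S e y by auto
      have "p y < T ((Q \<circ> e) i y) ((U \<circ> e) i)" using i(2) by (simp add: N_def)
      also have "\<dots> \<le> m y"
        unfolding m_def wsup_def using y i(1) by (auto intro!: Max_ge)
      finally show ?thesis by simp
    qed
    then have "\<phi> p \<le> \<phi> m" using char_mono p m by blast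
    also have "\<phi> m = Max (insert 0 ((\<lambda>i. T (\<phi> ((Q \<circ> e) i)) ((U \<circ> e) i)) ` ?I))"
      unfolding m_def using QUe by (intro char_wsup) simp_all
    \<comment> \<open>A finite maximum of values below \<open>\<phi> p\<close> stays below it;
      \<open>pos\<close> accounts for the inserted 0, also when \<open>n\<close> is 0.\<close>
    also have "\<dots> < \<phi> p" using pos QUe(3) by simp
    finally show False by simp
  qed
  then show thesis using that by blast
qed

text \<open>The function r = hom(q y, q) is 1 at \<open>y\<close>, hence has \<phi>-value 1, while
  its copower by \<open>q y\<close> lies below \<open>q\<close> by the adjunction. The \<phi>-value
  of this copower is \<open>q y\<close>.\<close>

lemma char_evaluation_le:
  assumes y: "y \<in> points Y" and one: "\<And>q. q \<in> CX Y \<Longrightarrow> q y = 1 \<Longrightarrow> \<phi> q = 1" and q: "q \<in> CX Y"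
  shows "q y \<le> \<phi> q"
proof -
  have qy: "q y \<in> {0..1}" using C_mem[OF Y q y] .
  define r where "r = (\<lambda>z\<in>points Y. ihom T (q y) (q z))"
  have r: "r \<in> CX Y" unfolding r_def using C_ihom[OF Y q qy] .
  have "r y = 1" using ihom_eq_one_iff[OF qy qy] y by (simp add: r_def)
  then have "\<phi> r = 1" using one r by blast
  then have "q y = \<phi> (\<lambda>z\<in>points Y. T (r z) (q y))"
    using char_copower[OF r qy] T_one_left[OF qy] by simp
  also have "\<dots> \<le> \<phi> q"
  proof (rule char_mono[OF C_copower[OF Y r qy] q])
    fix z assume z: "z \<in> points Y"
    have qz: "q z \<in> {0..1}" "ihom T (q y) (q z) \<in> {0..1}" using C_mem[OF Y q z] ihom_mem[OF qy] by auto
    then show "(\<lambda>z\<in>points Y. T (r z) (q y)) z \<le> q z"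
      using T_le_iff[OF qy qz(2,1)] T_commute[OF qy qz(2)] z by (simp add: r_def)
  qed
  finally show ?thesis .
qed

text \<open>Powers are built by the iteration that \<open>T_archimedean\<close> uses, so that \<phi>
  carries them to the powers of \<open>\<phi> q\<close>.\<close>

lemma char_pow:
  assumes q: "q \<in> CX Y"
  defines "Q n \<equiv> ((\<lambda>r. q \<otimes>\<^bsub>C_obj T Y\<^esub> r) ^^ n) \<one>\<^bsub>C_obj T Y\<^esub>"
  shows "Q n \<in> CX Y" "\<phi> (Q n) = (T (\<phi> q) ^^ n) 1" "y \<in> points Y \<Longrightarrow> q y = 1 \<Longrightarrow> Q n y = 1"
proof (induction n)
  case 0
  show "Q 0 \<in> CX Y" "\<phi> (Q 0) = (T (\<phi> q) ^^ 0) 1" "y \<in> points Y \<Longrightarrow> q y = 1 \<Longrightarrow> Q 0 y = 1"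
    using C_one_mem[OF Y] char_one by (simp_all add: Q_def C_one)
next
  case (Suc n)
  have Q_Suc: "Q (Suc n) = q \<otimes>\<^bsub>C_obj T Y\<^esub> Q n" by (simp add: Q_def)
  show "Q (Suc n) \<in> CX Y" unfolding Q_Suc using C_mult_mem[OF Y q] Suc by blast
  show "\<phi> (Q (Suc n)) = (T (\<phi> q) ^^ Suc n) 1" unfolding Q_Suc using char_mult[OF q] Suc by simp
  show "Q (Suc n) y = 1" if "y \<in> points Y" "q y = 1"
    unfolding Q_Suc using Suc that T_one_left[of 1] by (simp add: C_mult)
qed

text \<open>Scaling \<open>p\<close> by some \<open>a < 1\<close> makes \<open>T (p y) a < 1\<close>, so that a power of any
  \<open>q\<close> with \<open>q y = 1\<close> exceeds it at \<open>y\<close>; by the Archimedean property this forces \<open>\<phi> q = 1\<close>.\<close>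

lemma char_evaluation_point:
  assumes p: "p \<in> CX Y" and pos: "0 < \<phi> p"
  obtains y where "y \<in> points Y" "\<phi> p \<le> p y" "\<And>q. q \<in> CX Y \<Longrightarrow> q y \<le> \<phi> q"
proof -
  \<comment> \<open>\<open>a\<close> lies below 1, so that the scaled function stays below 1 at
    every point, yet is large enough for its \<phi>-value to remain positive.\<close>
  obtain a where a01: "a \<in> {0..<1}" and "0 < T (\<phi> p) a"
    using T_pos_below_one[OF char_mem[OF p] pos] by blast
  then have a: "a \<in> {0..1}" by simp
  define pa where "pa = (\<lambda>y\<in>points Y. T (p y) a)"
  have pa: "pa \<in> CX Y" unfolding pa_def using C_copower[OF Y p a] .
  have \<phi>pa: "\<phi> pa = T (\<phi> p) a" unfolding pa_def using char_copower[OF p a] .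
  then have pa_pos: "0 < \<phi> pa" using \<open>0 < T (\<phi> p) a\<close> by simp
  obtain y where y: "y \<in> points Y"
    and dom: "\<And>q u. q \<in> CX Y \<Longrightarrow> u \<in> {0..1} \<Longrightarrow> pa y < T (q y) u \<Longrightarrow> \<phi> pa \<le> T (\<phi> q) u"
    using char_dominating_point[OF pa pa_pos] by blast
  have py: "p y \<in> {0..1}" using C_mem[OF Y p y] .
  have pay: "pa y = T (p y) a" using y by (simp add: pa_def)
  have "pa y < 1" using T_le_right[OF py a] a01 pay by auto
  have "\<phi> q = 1" if q: "q \<in> CX Y" "q y = 1" for q
  proof (rule T_archimedean[OF char_mem[OF q(1)] pa_pos])
    fix n
    note Q = char_pow(1,2)[OF q(1), where n = n] char_pow(3)[OF q(1) y q(2), where n = n]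
    show "\<phi> pa \<le> (T (\<phi> q) ^^ n) 1"
      using dom[OF Q(1), of 1] Q(3) \<open>pa y < 1\<close> T_one_right[of 1]
        T_one_right[OF char_mem[OF Q(1)]] Q(2) by simp
  qed
  then have le: "q y \<le> \<phi> q" if "q \<in> CX Y" for q
    using char_evaluation_le[OF y _ that] by blast
  \<comment> \<open>\<open>dom\<close> is applied to the unit function with each \<open>u\<close>
    strictly between \<open>pa y\<close> and 1; density then gives the bound.\<close>
  have "\<phi> pa \<le> pa y"
  proof (rule dense_ge_bounded[OF \<open>pa y < 1\<close>])
    fix u assume u: "pa y < u" "u < 1"
    then have u01: "u \<in> {0..1}" using C_mem[OF Y pa y] by simp
    show "\<phi> pa \<le> u"
      using dom[OF C_one_mem[OF Y] u01] u(1) y char_one T_one_left[OF u01] by (simp add: C_one)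
  qed
  then have "T (\<phi> p) a \<le> T (p y) a" using \<phi>pa pay by simp
  \<comment> \<open>Positivity of \<open>T (\<phi> p) a\<close> is what permits cancelling
    \<open>a\<close>.\<close>
  then have "\<phi> p \<le> p y"
    using T_cancel[OF char_mem[OF p] py a \<open>0 < T (\<phi> p) a\<close>] by blast
  then show thesis using that y le by blast
qed

text \<open>An evaluation point for \<open>p\<close> has \<open>\<phi> p \<le> p y\<close>, so
  hom(\<phi> p, p) is 1 there, and \<phi> dominates evaluation at that point. If
  \<open>\<phi> p = 0\<close> no such point is supplied, but hom(0, p) is constantly 1.\<close>

lemma char_ihom:
  assumes p: "p \<in> CX Y"
  shows "\<phi> (\<lambda>y\<in>points Y. ihom T (\<phi> p) (p y)) = 1"
proof (cases "\<phi> p = 0")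
  case True
  have "(\<lambda>y\<in>points Y. ihom T (\<phi> p) (p y)) = (\<lambda>y\<in>points Y. 1)"
    using ihom_eq_one_iff[OF char_mem[OF p] C_mem[OF Y p]] C_mem[OF Y p] True
    by (intro restrict_ext) simp
  then show ?thesis using char_const[of 1] by simp
next
  case False
  let ?r = "\<lambda>y\<in>points Y. ihom T (\<phi> p) (p y)"
  have r: "?r \<in> CX Y" using C_ihom[OF Y p char_mem[OF p]] .
  have "0 < \<phi> p" using char_mem[OF p] False by simp
  then obtain y where y: "y \<in> points Y" "\<phi> p \<le> p y" "?r y \<le> \<phi> ?r"
    using char_evaluation_point[OF p] r by metis
  moreover have "?r y = 1"
    using y ihom_eq_one_iff[OF char_mem[OF p] C_mem[OF Y p y(1)]] by simp
  ultimately show ?thesis using char_mem[OF r] by simp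
qed

text \<open>\<open>P\<close> is the product of the functions hom(\<phi> q, q) for \<open>q\<close>
  in \<open>J\<close>. Each has \<phi>-value 1, and a product equal to 1 forces every factor to be
  1.\<close>

lemma char_finite_witness:
  assumes "finite J" "J \<subseteq> CX Y"
  shows "\<exists>P\<in>CX Y. \<phi> P = 1 \<and> (\<forall>y\<in>points Y. P y = 1 \<longrightarrow> (\<forall>q\<in>J. \<phi> q \<le> q y))"
  using assms
proof (induction J rule: finite_induct)
  case empty
  then show ?case using C_one_mem[OF Y] char_one by auto
next
  case (insert q J)
  then obtain P where P: "P \<in> CX Y" "\<phi> P = 1" "\<And>y r. y \<in> points Y \<Longrightarrow> P y = 1 \<Longrightarrow> r \<in> J \<Longrightarrow> \<phi> r \<le> r y"
    by auto
  have q: "q \<in> CX Y" using insert by simp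
  let ?r = "\<lambda>y\<in>points Y. ihom T (\<phi> q) (q y)"
  have r: "?r \<in> CX Y" using C_ihom[OF Y q char_mem[OF q]] .
  let ?P = "?r \<otimes>\<^bsub>C_obj T Y\<^esub> P"
  have "?P \<in> CX Y" using C_mult_mem[OF Y r P(1)] .
  moreover have "\<phi> ?P = 1"
    using char_mult[OF r P(1)] char_ihom[OF q] P(2) T_one_left[of 1] by simp
  moreover have "\<phi> s \<le> s y" if y: "y \<in> points Y" and eq: "?P y = 1" and s: "s \<in> insert q J" for y s
  proof -
    have mem: "?r y \<in> {0..1}" "P y \<in> {0..1}" using C_mem[OF Y r y] C_mem[OF Y P(1) y] .
    have "T (?r y) (P y) = 1" using eq y by (simp add: C_mult)
    then have "?r y = 1" "P y = 1"
      using T_le_left[OF mem] T_le_right[OF mem] mem by auto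
    then show ?thesis
      using P(3)[OF y] s y ihom_eq_one_iff[OF char_mem[OF q] C_mem[OF Y q y]] by auto
  qed
  ultimately show ?case by blast
qed

text \<open>The closed sets \<open>E q\<close> have the finite intersection property: an evaluation
  point for the witness of a finite \<open>J\<close> satisfies both inequalities between \<phi> and
  evaluation on \<open>J\<close>. Compactness gives a common point.\<close>

theorem char_eq_evaluation:
  obtains y where "y \<in> points Y" "\<And>q. q \<in> CX Y \<Longrightarrow> \<phi> q = q y"
proof -
  define E where "E q = {y \<in> points Y. q y = \<phi> q}" for q
  have closed: "closedin (ptop Y) (E q)" if "q \<in> CX Y" for q
  proof -
    have "continuous_map (ptop Y) euclideanreal q"
      using C_continuous[OF Y that] .
    then have "closedin (ptop Y) {y \<in> points Y. q y \<in> {\<phi> q}}"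
      by (rule closedin_continuous_map_preimage) simp
    then show ?thesis by (simp add: E_def)
  qed
  have "\<Inter> \<F> \<noteq> {}" if F: "finite \<F>" "\<F> \<subseteq> E ` CX Y" for \<F>
  proof -
    obtain J where J: "finite J" "J \<subseteq> CX Y" "\<F> = E ` J"
      using finite_subset_image[OF F] by blast
    obtain P where P: "P \<in> CX Y" "\<phi> P = 1" "\<forall>y\<in>points Y. P y = 1 \<longrightarrow> (\<forall>q\<in>J. \<phi> q \<le> q y)"
      using char_finite_witness[OF J(1,2)] by blast
    then obtain y where y: "y \<in> points Y" "\<phi> P \<le> P y" "\<And>q. q \<in> CX Y \<Longrightarrow> q y \<le> \<phi> q"
      using char_evaluation_point[OF P(1)] by (metis zero_less_one)
    then have "P y = 1" using C_mem[OF Y P(1) y(1)] P(2) by simp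
    then have "y \<in> E q" if "q \<in> J" for q
      using P(3) y that J(2) by (force simp: E_def)
    then show ?thesis using J(3) by blast
  qed
  then have "\<Inter> (E ` CX Y) \<noteq> {}"
    using Y closed unfolding poscomp_def compact_space_fip by (metis (no_types, lifting) imageE)
  then obtain y where y: "y \<in> E q" if "q \<in> CX Y" for q by blast
  show thesis
    using y[OF C_one_mem[OF Y]] y by (intro that[of y]) (simp_all add: E_def)
qed

end

section \<open>Faithfulness and fullness of \<open>C\<close>\<close>

context tensor
begin

lemma mon_finsup_hom_C_iff:
  assumes X: "poscomp X" and Y: "poscomp Y"
  shows "F \<in> mon_finsup_hom T (C_obj T Y) (C_obj T X) \<longleftrightarrow>
    F \<in> extensional (CX Y) \<and> F \<in> hom (C_obj T Y) (C_obj T X) \<and>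
    ufunctor (CX Y) (dX Y) (CX X) (dX X) F \<and>
    (\<forall>(I :: nat set) h w. finite I \<and> (\<forall>i\<in>I. h i \<in> CX Y \<and> w i \<in> {0..1}) \<longrightarrow>
      F (wsup Y I h w) = wsup X I (F \<circ> h) w) \<and>
    F \<one>\<^bsub>C_obj T Y\<^esub> = \<one>\<^bsub>C_obj T X\<^esub>"
  by (simp add: mon_finsup_hom_def C_carrier[OF X] C_carrier[OF Y] fin_cocontinuous_C_iff[OF X Y])

lemma character_of_hom:
  assumes X: "poscomp X" and Y: "poscomp Y" and F: "F \<in> mon_finsup_hom T (C_obj T Y) (C_obj T X)"
    and x: "x \<in> points X"
  shows "character T Y (\<lambda>p. F p x)"
proof -
  note F' = F[unfolded mon_finsup_hom_C_iff[OF X Y]]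
  have mem: "F p \<in> CX X" if "p \<in> CX Y" for p
    using F' that by (auto simp: ufunctor_def)
  show ?thesis
  proof (intro character.intro character_axioms.intro tensor_axioms Y)
    show "F p x \<in> {0..1}" if "p \<in> CX Y" for p using C_mem[OF X mem[OF that] x] .
    show "F p x \<le> F q x" if "p \<in> CX Y" "q \<in> CX Y" "\<And>y. y \<in> points Y \<Longrightarrow> p y \<le> q y" for p q
    proof -
      have "dX Y p q = 1" using C_hom_eq_one_iff[OF Y that(1,2)] that(3) by simp
      moreover have "dX Y p q \<le> dX X (F p) (F q)" using F' that(1,2) by (simp add: ufunctor_def)
      ultimately have "dX X (F p) (F q) = 1"
        using C_hom_mem[OF X mem[OF that(1)] mem[OF that(2)]] by simp
      then show ?thesis using C_hom_eq_one_iff[OF X mem[OF that(1)] mem[OF that(2)]] x by simp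
    qed
    show "F \<one>\<^bsub>C_obj T Y\<^esub> x = 1" using F' x by (simp add: C_one)
    show "F (p \<otimes>\<^bsub>C_obj T Y\<^esub> q) x = T (F p x) (F q x)" if "p \<in> CX Y" "q \<in> CX Y" for p q
    proof -
      have "F (p \<otimes>\<^bsub>C_obj T Y\<^esub> q) = F p \<otimes>\<^bsub>C_obj T X\<^esub> F q"
        using F' that by (simp add: hom_def C_carrier[OF Y])
      then show ?thesis using x by (simp add: C_mult)
    qed
    show "F (wsup Y I h w) x = Max (insert 0 ((\<lambda>i. T (F (h i) x) (w i)) ` I))"
      if "finite I" "\<And>i. i \<in> I \<Longrightarrow> h i \<in> CX Y" "\<And>i. i \<in> I \<Longrightarrow> w i \<in> {0..1}"
      for I :: "nat set" and h w
    proof -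
      have "F (wsup Y I h w) = wsup X I (F \<circ> h) w" using F' that by simp
      then show ?thesis using x by (simp add: wsup_def)
    qed
  qed
qed

text \<open>The ordered Urysohn lemma enters here: were the pair not in the order, it would supply a
  function in \<open>CY\<close> that violates the inequality.\<close>

lemma C_order_determined:
  assumes Y: "poscomp Y" and "y \<in> points Y" "y' \<in> points Y" "\<And>p. p \<in> CX Y \<Longrightarrow> p y' \<le> p y"
  shows "(y, y') \<in> pord Y"
proof (rule ccontr)
  assume "(y, y') \<notin> pord Y"
  then obtain p where "p \<in> CX Y" "p y < p y'" by (rule ordered_Urysohn[OF Y assms(2,3)])
  then show False using assms(4)[of p] by simp
qed

lemma C_separates_points:
  assumes Y: "poscomp Y" and "y \<in> points Y" "y' \<in> points Y" "\<And>p. p \<in> CX Y \<Longrightarrow> p y = p y'"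
  shows "y = y'"
proof (rule poscomp_antisym[OF Y])
  have le: "p y' \<le> p y" "p y \<le> p y'" if "p \<in> CX Y" for p
    using assms(4)[OF that] by simp_all
  show "(y, y') \<in> pord Y" by (rule C_order_determined[OF Y assms(2,3)]) (rule le(1))
  show "(y', y) \<in> pord Y" by (rule C_order_determined[OF Y assms(3,2)]) (rule le(2))
qed

text \<open>Faithfulness: maps with equal images agree after composition with every function in
  \<open>CY\<close>, and these separate points.\<close>

lemma C_map_inj:
  assumes Y: "poscomp Y"
  shows "inj_on (C_map X Y) (poscomp_hom X Y)"
proof (rule inj_onI)
  fix f g assume f: "f \<in> poscomp_hom X Y" and g: "g \<in> poscomp_hom X Y" and eq: "C_map X Y f = C_map X Y g"
  show "f = g"
  proof (rule extensionalityI)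
    fix x assume x: "x \<in> points X"
    show "f x = g x"
    proof (rule C_separates_points[OF Y])
      show "f x \<in> points Y" "g x \<in> points Y"
        using f g x by (auto simp: poscomp_hom_def continuous_map_def)
      show "p (f x) = p (g x)" if "p \<in> CX Y" for p
        using C_map_apply[OF that x] eq by metis
    qed
  qed (use f g in \<open>auto simp: poscomp_hom_def\<close>)
qed

text \<open>The map \<open>f\<close> that represents \<open>F\<close> has the closed graph \<open>R\<close>, so it is continuous
  because the target space is compact.\<close>

lemma C_map_surj:
  assumes X: "poscomp X" and Y: "poscomp Y" and F: "F \<in> mon_finsup_hom T (C_obj T Y) (C_obj T X)"
  shows "F \<in> C_map X Y ` poscomp_hom X Y"
proof -
  note F' = F[unfolded mon_finsup_hom_C_iff[OF X Y]]
  have mem: "F p \<in> CX X" if "p \<in> CX Y" for p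
    using F' that by (auto simp: ufunctor_def)
  have "\<exists>y\<in>points Y. \<forall>q\<in>CX Y. F q x = q y" if "x \<in> points X" for x
    using character.char_eq_evaluation[OF character_of_hom[OF X Y F that]] by metis
  then obtain f where f: "\<And>x. x \<in> points X \<Longrightarrow> f x \<in> points Y"
    and Ff: "\<And>x q. x \<in> points X \<Longrightarrow> q \<in> CX Y \<Longrightarrow> F q x = q (f x)"
    by metis
  let ?P = "prod_topology (ptop X) (ptop Y)"
  \<comment> \<open>\<open>R\<close> is written as an intersection of closed conditions without
    mention of \<open>f\<close>, which makes it visibly closed; that it is the graph of
    \<open>f\<close> is left to \<open>R_iff\<close>.\<close>
  define R where "R = (\<Inter>q\<in>CX Y. {z \<in> topspace ?P. F q (fst z) - q (snd z) \<in> {0}})"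
  have "closedin ?P R" unfolding R_def
  proof (rule closedin_INT)
    show "CX Y \<noteq> {}" using C_one_mem[OF Y] by blast
    fix q assume q: "q \<in> CX Y"
    have "continuous_map ?P euclideanreal (\<lambda>z. F q (fst z) - q (snd z))"
      using continuous_map_compose[OF continuous_map_fst C_continuous[OF X mem[OF q]]]
        continuous_map_compose[OF continuous_map_snd C_continuous[OF Y q]]
      by (intro continuous_map_diff) (simp_all add: o_def)
    then show "closedin ?P {z \<in> topspace ?P. F q (fst z) - q (snd z) \<in> {0}}"
      by (rule closedin_continuous_map_preimage) simp
  qed
  have R_iff: "(x, y) \<in> R \<longleftrightarrow> x \<in> points X \<and> y = f x" for x y
  proof
    assume "(x, y) \<in> R"
    \<comment> \<open>Since \<open>CY\<close> contains the unit, the intersection is over a nonempty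
      family and so lies in the product space.\<close>
    then have "x \<in> points X" "y \<in> points Y" "\<And>q. q \<in> CX Y \<Longrightarrow> F q x = q y"
      unfolding R_def using C_one_mem[OF Y] by fastforce+
    then show "x \<in> points X \<and> y = f x"
      using C_separates_points[OF Y] f Ff by metis
  qed (use f Ff C_one_mem[OF Y] in \<open>auto simp: R_def\<close>)
  have "continuous_map (ptop X) (ptop Y) f"
    unfolding continuous_map_closedin
  proof (intro conjI allI impI)
    fix K assume K: "closedin (ptop Y) K"
    have "closedin ?P (R \<inter> points X \<times> K)"
      using K \<open>closedin ?P R\<close> by (intro closedin_Int) (auto simp: closedin_prod_Times_iff)
    moreover have "fst ` (R \<inter> points X \<times> K) = {x \<in> points X. f x \<in> K}"
      by (force simp: R_iff image_iff)
    ultimately show "closedin (ptop X) {x \<in> points X. f x \<in> K}"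
      using Y closed_map_fst[of "ptop Y" "ptop X"] unfolding closed_map_def poscomp_def by metis
  qed (use f in auto)
  \<comment> \<open>Every \<open>F p\<close> reverses the order of \<open>X\<close> and agrees with
    \<open>p\<close> after \<open>f\<close>, so every \<open>p\<close> in \<open>CY\<close>
    satisfies \<open>p (f x') \<le> p (f x)\<close>, which determines the order.\<close>
  moreover have "(f x, f x') \<in> pord Y" if "(x, x') \<in> pord X" for x x'
    using C_antimono[OF X mem that] poscomp_ordD[OF X that] f Ff
    by (intro C_order_determined[OF Y]) auto
  ultimately have hom: "restrict f (points X) \<in> poscomp_hom X Y"
    by (auto simp: poscomp_hom_def monotone_on_def intro: continuous_map_eq[of _ _ f])
  moreover have "F = C_map X Y (restrict f (points X))"
  proof (rule extensionalityI)
    fix q assume q: "q \<in> CX Y"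
    show "F q = C_map X Y (restrict f (points X)) q"
      by (rule C_eqI[OF X mem[OF q] C_map_mem[OF hom q]]) (simp add: Ff[OF _ q] C_map_apply[OF q])
  qed (use F' in \<open>simp_all add: C_map_def\<close>)
  ultimately show ?thesis by blast
qed

lemma C_map_bij:
  assumes "poscomp X" "poscomp Y"
  shows "bij_betw (C_map X Y) (poscomp_hom X Y) (mon_finsup_hom T (C_obj T Y) (C_obj T X))"
  unfolding bij_betw_def using C_map_inj C_map_surj C_map_hom assms by blast

lemma C_map_id:
  assumes "poscomp X"
  shows "C_map X X (\<lambda>x\<in>points X. x) = (\<lambda>p\<in>CX X. p)"
  unfolding C_map_def
proof (rule restrict_ext)
  fix p assume "p \<in> CX X"
  then have "p \<in> extensional (points X)" by (simp add: poscomp_hom_def)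
  then show "compose (points X) p (\<lambda>x\<in>points X. x) = p"
    by (intro compose_Id[where B = UNIV]) simp_all
qed

lemma C_map_compose:
  assumes "f \<in> poscomp_hom X Y" "g \<in> poscomp_hom Y Z"
  shows "C_map X Z (compose (points X) g f) = compose (CX Z) (C_map X Y f) (C_map Y Z g)"
proof -
  have "f \<in> points X \<rightarrow> points Y" using assms(1) by (auto simp: poscomp_hom_def continuous_map_def)
  then have "compose (points X) p (compose (points X) g f)
      = C_map X Y f (compose (points Y) p g)" if "p \<in> CX Z" for p
    using compose_assoc[of f "points X" "points Y" p g] poscomp_hom_compose[OF assms(2) that]
    by (simp add: C_map_def)
  then show ?thesis by (auto simp: C_map_def[of _ Z] compose_def[of "CX Z"])
qed

end

section \<open>Multiplication and the Lukasiewicz tensor satisfy the requirements\<close>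

lemma ihom_mult:
  assumes "u \<in> {0..1}" "w \<in> {0..1}"
  shows "ihom (\<lambda>u v. u * v) u w = (if u \<le> w then 1 else w / u)"
proof (rule ihom_eqI)
  \<comment> \<open>The case \<open>u = 0\<close> falls under \<open>u \<le> w\<close>, so the
    quotient is only taken for positive \<open>u\<close>.\<close>
  show "(if u \<le> w then 1 else w / u) \<in> {0..1}" using assms by auto
  fix v :: real assume v: "v \<in> {0..1}"
  have "u * v \<le> u" using v assms by (simp add: mult_left_le)
  then show "u * v \<le> w \<longleftrightarrow> v \<le> (if u \<le> w then 1 else w / u)"
    using assms v by (auto simp: field_simps)
qed

lemma tensor_mult: "tensor (\<lambda>u v. u * v)"
proof
  fix u c :: real assume u: "u \<in> {0..1}" and c: "0 < c" "\<And>n. c \<le> (((*) u) ^^ n) 1"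
  have "(((*) u) ^^ n) 1 = u ^ n" for n by (induction n) simp_all
  then show "u = 1" using u c real_arch_pow_inv[of c u] by (metis atLeastAtMost_iff not_le order_le_less)
next
  fix u :: real assume u: "u \<in> {0..1}"
  show "continuous_on {0..1} (ihom (\<lambda>u v. u * v) u)"
  proof (cases "u = 0")
    case True
    have "continuous_on {0..1} (\<lambda>_::real. 1::real)" by simp
    then show ?thesis by (rule continuous_on_eq) (use True in \<open>simp add: ihom_mult\<close>)
  next
    case False
    \<comment> \<open>For positive \<open>u\<close> this is \<open>ihom\<close> on the unit
      interval, in a form that is evidently continuous.\<close>
    have "continuous_on {0..1} (\<lambda>w. min 1 (w / u))" using False by (intro continuous_intros) auto
    then show ?thesis by (rule continuous_on_eq) (use False u in \<open>auto simp: ihom_mult min_def field_simps\<close>)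
  qed
next
  fix u v w :: real assume uvw: "u \<in> {0..1}" "v \<in> {0..1}" "w \<in> {0..1}"
  have "u * v \<le> u" using uvw by (simp add: mult_left_le)
  then show "u * v \<le> w \<longleftrightarrow> v \<le> ihom (\<lambda>u v. u * v) u w"
    using uvw by (auto simp: ihom_mult field_simps)
next
  fix u :: real assume "u \<in> {0..1}" "0 < u"
  then show "\<exists>a\<in>{0..<1}. 0 < u * a" by (intro bexI[of _ "1/2"]) auto
qed (auto simp: ihom_mult mult_le_one mult_left_mono case_prod_beta zero_less_mult_iff intro!: continuous_intros)

lemma ihom_lukasiewicz:
  assumes "u \<in> {0..1}" "w \<in> {0..1}"
  shows "ihom lukasiewicz u w = min 1 (1 - u + w)"
  using assms by (intro ihom_eqI) (auto simp: lukasiewicz_def)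

lemma tensor_lukasiewicz: "tensor lukasiewicz"
proof
  fix u c :: real assume u: "u \<in> {0..1}" and c: "0 < c" "\<And>n. c \<le> (lukasiewicz u ^^ n) 1"
  \<comment> \<open>The bound is linear in \<open>n\<close> until it is truncated at 0, so for
    \<open>u < 1\<close> the powers vanish from some \<open>n\<close> on.\<close>
  have bound: "(lukasiewicz u ^^ n) 1 \<le> max 0 (1 - real n * (1 - u))" for n
    using u by (induction n) (auto simp: lukasiewicz_def algebra_simps max_def split: if_splits)
  show "u = 1"
  proof (rule ccontr)
    assume "u \<noteq> 1"
    then obtain n :: nat where "1 < real n * (1 - u)"
      using u reals_Archimedean3[of "1 - u"] by auto
    then show False using bound[of n] c(1) c(2)[of n] by (auto simp: max_def split: if_splits)
  qed
next
  fix u :: real assume u: "u \<in> {0..1}"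
  have "continuous_on {0..1} (\<lambda>w. min 1 (1 - u + w))" by (intro continuous_intros)
  then show "continuous_on {0..1} (ihom lukasiewicz u)"
    by (rule continuous_on_eq) (use u in \<open>simp add: ihom_lukasiewicz\<close>)
next
  fix u :: real assume "u \<in> {0..1}" "0 < u"
  \<comment> \<open>The witness \<open>1 - u / 2\<close> gives the product
    \<open>u / 2\<close>.\<close>
  then show "\<exists>a\<in>{0..<1}. 0 < lukasiewicz u a"
    by (intro bexI[of _ "1 - u / 2"]) (auto simp: lukasiewicz_def)
next
  show "continuous_on ({0..1} \<times> {0..1}) (\<lambda>(u, v). lukasiewicz u v)"
    unfolding lukasiewicz_def case_prod_beta by (intro continuous_intros)
qed (auto simp: ihom_lukasiewicz lukasiewicz_def max_def split: if_splits)

theorem corollary6p15: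
  fixes T :: "real \<Rightarrow> real \<Rightarrow> real"
  assumes "T = (\<lambda>u v. u * v) \<or> T = lukasiewicz"
  shows
    "(\<forall>X :: 'a pospace. poscomp X \<longrightarrow> mon_finsup T (C_obj T X) \<and> C_pointwise T X) \<and>
     (\<forall>(X :: 'a pospace) (Y :: 'b pospace). poscomp X \<and> poscomp Y \<longrightarrow>
        C_map X Y \<in> poscomp_hom X Y \<rightarrow> mon_finsup_hom T (C_obj T Y) (C_obj T X)) \<and>
     (\<forall>X :: 'a pospace. poscomp X \<longrightarrow>
        C_map X X (\<lambda>x\<in>points X. x) = (\<lambda>p\<in>carrier (C_obj T X). p)) \<and>
     (\<forall>(X :: 'a pospace) (Y :: 'b pospace) (Z :: 'c pospace). poscomp X \<and> poscomp Y \<and> poscomp Z \<longrightarrow>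
        (\<forall>f\<in>poscomp_hom X Y. \<forall>g\<in>poscomp_hom Y Z.
           C_map X Z (compose (points X) g f) =
           compose (carrier (C_obj T Z)) (C_map X Y f) (C_map Y Z g))) \<and>
     (\<forall>(X :: 'a pospace) (Y :: 'b pospace). poscomp X \<and> poscomp Y \<longrightarrow>
        bij_betw (C_map X Y) (poscomp_hom X Y) (mon_finsup_hom T (C_obj T Y) (C_obj T X)))"
proof -
  interpret tensor T
    using assms tensor_mult tensor_lukasiewicz by auto
  show ?thesis
    by (simp add: C_mon_finsup C_pointwise C_map_hom C_map_id C_map_compose C_map_bij C_carrier)
qed

end
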